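(* The pricing query complexity of learning the CDF of a regular distribution supported on $[0,1]$ within Lévy distance $\epsilon$ is $\tilde{O}(\epsilon^{-5/2})$: there is an algorithm that, for every regular distribution $F$ on $[0,1]$, uses $\tilde{O}(\epsilon^{-5/2})$ pricing queries and outputs $\hat F$ with $\mathrm{L\acute{e}vy}(F,\hat F)\le\epsilon$ with high probability. This is tight up to polylogarithmic factors, i.e. $\Omega(\epsilon^{-5/2})$ pricing queries are necessary.
   Context: A distribution with CDF $F$ is regular if $R(q)=qF^{-1}(1-q)$ is concave on $[0,1]$. Pricing query model: in each round $t$ the algorithm (adaptively) chooses a price $p_t$, a fresh sample $v_t\sim F$ is drawn independently, and the algorithm observes only $\mathrm{sign}(v_t-p_t)\in\{-1,+1\}$. Lévy distance: $\mathrm{L\acute{e}vy}(F,G)=\inf\{\epsilon: F(v-\epsilon)-\epsilon\le G(v)\le F(v+\epsilon)+\epsilon\ \forall v\}$. $\tilde{O}$ hides polylog$(1/\epsilon)$ factors. *)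

theory Defs
  imports "HOL-Probability.Probability"
begin

definition dist01 :: "real measure \<Rightarrow> bool" where
  "dist01 M \<longleftrightarrow> prob_space M \<and> sets M = sets borel \<and> measure M {0..1} = 1"

definition quantile01 :: "(real \<Rightarrow> real) \<Rightarrow> real \<Rightarrow> real" where
  "quantile01 F y = Inf {v \<in> {0..1}. F v \<ge> y}"

definition revenue_curve :: "(real \<Rightarrow> real) \<Rightarrow> real \<Rightarrow> real" where
  "revenue_curve F q = q * quantile01 F (1 - q)"

definition regular01 :: "real measure \<Rightarrow> bool" where
  "regular01 M \<longleftrightarrow> dist01 M \<and> concave_on {0..1} (revenue_curve (cdf M))"

text \<open>Levy distance (in the extended reals; infimum of the empty set is infinity).\<close>
definition levy :: "(real \<Rightarrow> real) \<Rightarrow> (real \<Rightarrow> real) \<Rightarrow> ereal" where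
  "levy F G = (INF e \<in> {e::real. e \<ge> 0 \<and>
      (\<forall>v. F (v - e) - e \<le> G v \<and> G v \<le> F (v + e) + e)}. ereal e)"

text \<open>A deterministic adaptive pricing algorithm: the next price as a function of the
  history of feedback bits so far (True = sign(v - p) = +1, i.e. v >= p), and the
  output CDF estimate as a function of the full history.\<close>
type_synonym pricing_alg = "(bool list \<Rightarrow> real) \<times> (bool list \<Rightarrow> real \<Rightarrow> real)"

definition hist_prob :: "real measure \<Rightarrow> (bool list \<Rightarrow> real) \<Rightarrow> bool list \<Rightarrow> real" where
  "hist_prob M P h = (\<Prod>i<length h.
      if h ! i then measure M {P (take i h)..} else measure M {..<P (take i h)})"

definition det_success :: "real measure \<Rightarrow> pricing_alg \<Rightarrow> nat \<Rightarrow> real \<Rightarrow> real" where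
  "det_success M A n \<epsilon> = (\<Sum>h\<in>{h::bool list. length h = n}.
      hist_prob M (fst A) h * (if levy (cdf M) (snd A h) \<le> ereal \<epsilon> then 1 else 0))"

text \<open>A randomized algorithm is a probability measure Q over deterministic algorithms;
  its success probability is the (lower) integral of the deterministic ones.\<close>
definition rand_success :: "pricing_alg measure \<Rightarrow> real measure \<Rightarrow> nat \<Rightarrow> real \<Rightarrow> ennreal" where
  "rand_success Q M n \<epsilon> = (\<integral>\<^sup>+ A. ennreal (det_success M A n \<epsilon>) \<partial>Q)"

end

theory Submission
  imports Defs
begin

text \<open>
  A distribution is regular iff the reciprocal of its sale probability \<open>S(p) = P(v \<ge> p)\<close> is convex.

  Upper bound: refine dyadic intervals adaptively, stopping at an interval once all regular
  distributions compatible with the estimates agree on it. Convexity confines \<open>1 / S\<close> on an interval between its chord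
  and the extension of the chord to the left, so an interval stays undecided only if \<open>S\<close>
  halves on it or \<open>1 / S\<close> has a second difference of order at least \<open>\<epsilon> / S\<^sup>2\<close>.
  The increments of \<open>1 / S\<close> sum up to its range, hence only \<open>O(\<epsilon>\<^sup>-\<^sup>1\<^sup>/\<^sup>2)\<close> intervals per
  level and per dyadic class of \<open>S\<close> are undecided; each node costs \<open>\<epsilon>\<^sup>-\<^sup>2\<close> queries up to logarithms.

  Lower bound: take \<open>1 / S = 1 + v\<^sup>2\<close> and replace it by its secant on one of about
  \<open>\<epsilon>\<^sup>-\<^sup>1\<^sup>/\<^sup>2\<close> disjoint intervals of length \<open>12 \<epsilon>\<^sup>1\<^sup>/\<^sup>2\<close>. This moves \<open>S\<close> by order \<open>\<epsilon>\<close>, visibly in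
  Levy distance, and is detected only by \<open>\<epsilon>\<^sup>-\<^sup>2\<close> queries inside that interval.
\<close>

section \<open>Feedback histories and sale probabilities\<close>

text \<open>Regularity enters the upper bound through the three-point inequality for
  \<open>1 / S\<close>, which needs no density and tolerates atoms. The curvature of the true
  distribution is unknown to the algorithm, so it cannot serve as a stopping rule; it occurs only in
  the analysis, where it bounds how often the data-driven rule fails to stop. A jump of
  \<open>S\<close> may keep its interval undecided on every level: refinement ends at a width below
  \<open>e / 2\<close>, and the horizontal slack of the Levy distance absorbs the rest. In the lower
  bound all divergences run from the base distribution to a bump, so that the queries falling into
  the different intervals are counted under one law and add up to at most \<open>n\<close>. The
  factor 12 in the width lets the gap at a midpoint exceed the tolerance of two Levy balls.\<close>

lemma sum_lists_append:
  fixes f :: "bool list \<Rightarrow> 'a::comm_monoid_add"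
  shows "(\<Sum>h | length h = m + n. f h) = (\<Sum>h1 | length h1 = m. \<Sum>h2 | length h2 = n. f (h1 @ h2))"
proof -
  have "(\<Sum>h1 | length h1 = m. \<Sum>h2 | length h2 = n. f (h1 @ h2))
      = (\<Sum>(h1, h2) \<in> {h1. length h1 = m} \<times> {h2. length h2 = n}. f (h1 @ h2))"
    by (rule sum.cartesian_product)
  also have "\<dots> = (\<Sum>h | length h = m + n. f h)"
    by (rule sum.reindex_bij_witness[where i = "\<lambda>h. (take m h, drop m h)" and j = "\<lambda>(a, b). a @ b"]) auto
  finally show ?thesis ..
qed

lemma sum_lists_Suc:
  fixes f :: "bool list \<Rightarrow> 'a::comm_monoid_add"
  shows "(\<Sum>h | length h = Suc n. f h) = (\<Sum>h | length h = n. f (h @ [True]) + f (h @ [False]))"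
proof -
  have 1: "{h::bool list. length h = 1} = {[True], [False]}"
    by (auto simp: length_Suc_conv)
  show ?thesis using sum_lists_append[of f n 1] unfolding 1 by simp
qed

text \<open>The closed half-line matches the feedback \<open>v >= p\<close>. This is one minus the
  left limit of the CDF, and histories depend on the distribution through it alone.\<close>

definition sale :: "real measure \<Rightarrow> real \<Rightarrow> real" where
  "sale M p = measure M {p..}"

lemma sale_compl:
  assumes "dist01 M" shows "measure M {..<p} = 1 - sale M p"
proof -
  interpret prob_space M using assms by (simp add: dist01_def)
  have [simp, measurable_cong]: "sets M = sets borel" using assms by (simp add: dist01_def)
  have sp: "space M = UNIV" using sets_eq_imp_space_eq[of M borel] by simp
  have "{..<p} = space M - {p..}" using sp by auto
  then show ?thesis unfolding sale_def by (metis prob_compl \<open>sets M = sets borel\<close> atLeast_borel)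
qed

lemma sale_bounds:
  assumes "dist01 M" shows "0 \<le> sale M p" "sale M p \<le> 1"
proof -
  interpret prob_space M using assms by (simp add: dist01_def)
  show "0 \<le> sale M p" "sale M p \<le> 1" by (simp_all add: sale_def)
qed

lemma measure_mono_dist01:
  assumes "dist01 M" "A \<subseteq> B" "B \<in> sets borel" shows "measure M A \<le> measure M B"
proof -
  interpret prob_space M using assms by (simp add: dist01_def)
  show ?thesis using assms by (intro finite_measure_mono) (auto simp: dist01_def)
qed

lemma sale_antimono:
  assumes "dist01 M" "p \<le> q" shows "sale M q \<le> sale M p"
  unfolding sale_def using assms by (intro measure_mono_dist01) auto

lemma sale_nonpos:
  assumes "dist01 M" "p \<le> 0" shows "sale M p = 1"
proof -
  have "measure M {0..1} \<le> sale M p"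
    unfolding sale_def using assms by (intro measure_mono_dist01) auto
  with sale_bounds[OF assms(1), of p] assms show ?thesis by (simp add: dist01_def)
qed

lemma sale_gt_1:
  assumes "dist01 M" "p > 1" shows "sale M p = 0"
proof -
  have "measure M {0..1} \<le> measure M {..<p}"
    using assms by (intro measure_mono_dist01) auto
  with sale_bounds[OF assms(1), of p] assms sale_compl[OF assms(1), of p]
  show ?thesis by (simp add: dist01_def)
qed

text \<open>The strict inequality hides a possible atom: \<open>cdf\<close> includes the mass at its
  argument, \<open>1 - sale\<close> excludes it.\<close>

lemma cdf_sale:
  assumes "dist01 M" "u < v" shows "1 - sale M u \<le> cdf M u" "cdf M u \<le> 1 - sale M v"
  unfolding sale_compl[OF assms(1), symmetric] cdf_def
  using assms by (auto intro!: measure_mono_dist01)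

lemma hist_prob_Nil: "hist_prob M P [] = 1"
  by (simp add: hist_prob_def)

lemma hist_prob_snoc:
  assumes "dist01 M"
  shows "hist_prob M P (h @ [b]) = hist_prob M P h * (if b then sale M (P h) else 1 - sale M (P h))"
proof -
  have "hist_prob M P (h @ [b]) =
      (\<Prod>i<length h. if h ! i then sale M (P (take i h)) else 1 - sale M (P (take i h)))
      * (if b then sale M (P h) else 1 - sale M (P h))"
    unfolding hist_prob_def sale_compl[OF assms] sale_def[symmetric]
    by (auto simp: nth_append intro!: prod.cong)
  also have "(\<Prod>i<length h. if h ! i then sale M (P (take i h)) else 1 - sale M (P (take i h))) = hist_prob M P h"
    unfolding hist_prob_def sale_compl[OF assms] sale_def[symmetric] by simp
  finally show ?thesis .
qed

lemma hist_prob_append: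
  assumes "dist01 M"
  shows "hist_prob M P (h1 @ h2) = hist_prob M P h1 * hist_prob M (\<lambda>t. P (h1 @ t)) h2"
proof (induction h2 rule: rev_induct)
  case (snoc b h2)
  show ?case
    using hist_prob_snoc[OF assms, of P "h1 @ h2" b] hist_prob_snoc[OF assms, of "\<lambda>t. P (h1 @ t)" h2 b] snoc
    by simp
qed (simp add: hist_prob_Nil)

lemma hist_prob_nonneg:
  assumes "dist01 M" shows "0 \<le> hist_prob M P h"
  unfolding hist_prob_def by (intro prod_nonneg) auto

lemma sum_hist_prob:
  assumes "dist01 M" shows "(\<Sum>h | length h = n. hist_prob M P h) = 1"
proof (induction n)
  case (Suc n)
  show ?case
    unfolding sum_lists_Suc hist_prob_snoc[OF assms] using Suc
    by (simp flip: distrib_left)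
qed (simp add: hist_prob_Nil)

section \<open>Regularity as convexity of the reciprocal sale probability\<close>

lemma regular01_dist01: "regular01 M \<Longrightarrow> dist01 M"
  by (simp add: regular01_def)

lemma cdf_1: "dist01 M \<Longrightarrow> cdf M 1 = 1"
  using sale_bounds[of M 0] measure_mono_dist01[of M "{0..1}" "{..1}"] cdf_sale(2)[of M 1 2] sale_gt_1[of M 2]
  by (simp add: dist01_def cdf_def)

text \<open>Strictness of \<open>q < sale M p\<close> excludes every price below \<open>p\<close>
  from the set defining the quantile. Together with \<open>sale_ge_of_quantile01\<close> this
  inverts sale probabilities up to jumps.\<close>

lemma quantile01_ge:
  assumes "dist01 M" "p \<le> 1" "0 \<le> q" "q < sale M p"
  shows "p \<le> quantile01 (cdf M) (1 - q)"
  unfolding quantile01_def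
proof (rule cInf_greatest)
  show "{v \<in> {0..1}. 1 - q \<le> cdf M v} \<noteq> {}"
    using cdf_1[OF assms(1)] assms(3) by (auto intro!: exI[of _ 1])
next
  fix v assume "v \<in> {v \<in> {0..1}. 1 - q \<le> cdf M v}"
  then show "p \<le> v" using cdf_sale(2)[OF assms(1), of v p] assms(4) by force
qed

text \<open>Below \<open>y\<close> the CDF is at most \<open>1 - q\<close>, and its left limit at
  \<open>y\<close> is the mass of \<open>{..<y}\<close>, so an atom at \<open>y\<close> does no
  harm.\<close>

lemma sale_ge_of_quantile01:
  assumes "dist01 M" "0 < y" "y \<le> 1" "y \<le> quantile01 (cdf M) (1 - q)"
  shows "q \<le> sale M y"
proof -
  interpret prob_space M using assms by (simp add: dist01_def)
  have setsM: "sets M = sets borel" using assms by (simp add: dist01_def)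
  interpret finite_borel_measure M
    by standard (use setsM in auto)
  have "cdf M v \<le> 1 - q" if "0 < v" "v < y" for v
  proof (rule ccontr)
    assume "\<not> cdf M v \<le> 1 - q"
    then have "v \<in> {v \<in> {0..1}. 1 - q \<le> cdf M v}" using that assms by auto
    then have "quantile01 (cdf M) (1 - q) \<le> v"
      unfolding quantile01_def by (rule cInf_lower) (auto intro!: bdd_belowI[of _ 0])
    with that assms show False by simp
  qed
  then have "eventually (\<lambda>v. cdf M v \<le> 1 - q) (at_left y)"
    using assms(2) by (auto simp: eventually_at_left[of 0 y])
  from tendsto_upperbound[OF cdf_at_left this] have "measure M {..<y} \<le> 1 - q" by simp
  then show ?thesis using sale_compl[OF assms(1)] by simp
qed

text \<open>The revenues at the quantiles of \<open>x\<close> and \<open>u\<close> are mixed with weights inversely proportional to these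
  quantiles, so that concavity of the revenue curve bounds the price at the mixed quantile by \<open>y\<close> from below.
  Shrinking the quantiles by \<open>r < 1\<close> avoids the jumps of the quantile function.\<close>
lemma inverse_sale_convex:
  assumes reg: "regular01 M" and xy: "x < y" "y < u" and pos: "0 < sale M u"
  shows "(u - x) / sale M y \<le> (u - y) / sale M x + (y - x) / sale M u"
proof -
  have d: "dist01 M" using reg by (rule regular01_dist01)
  have u1: "u \<le> 1" using sale_gt_1[OF d, of u] pos by force
  have posx: "0 < sale M x" and posy: "0 < sale M y"
    using sale_antimono[OF d, of x u] sale_antimono[OF d, of y u] xy pos by auto
  show ?thesis
  \<comment> \<open>Quantiles live in \<open>{0..1}\<close> and say nothing about negative prices,
    but there \<open>1 / S = 1\<close>, its least value.\<close>
  proof (cases "y \<le> 0")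
    case True
    then have "sale M y = 1" "sale M x = 1" using sale_nonpos[OF d] xy by auto
    moreover have "(y - x) / sale M u \<ge> y - x"
      using pos sale_bounds[OF d, of u] xy by (simp add: pos_le_divide_eq mult_left_le)
    ultimately show ?thesis by simp
  next
    case False
    define a where "a = (u - y) / (u - x)"
    define b where "b = (y - x) / (u - x)"
    have ab: "a > 0" "b > 0" "a + b = 1" "a * x + b * u = y"
      using xy by (auto simp: a_def b_def add_divide_distrib[symmetric] divide_simps) (simp add: algebra_simps)
    have "r * (1 / (a / sale M x + b / sale M u)) \<le> sale M y" if r: "0 < r" "r < 1" for r
    proof -
      define q1 where "q1 = r * sale M x"
      define q2 where "q2 = r * sale M u"
      have q: "0 < q1" "0 < q2" "q1 < sale M x" "q2 < sale M u"
        using r posx pos by (auto simp: q1_def q2_def)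
      define W where "W = a / q1 + b / q2"
      have W: "W > 0" using q ab by (auto simp: W_def intro!: add_pos_pos)
      define t where "t = b / q2 / W"
      have t: "0 \<le> t" "1 - t = a / q1 / W" using W q ab by (auto simp: t_def W_def field_simps)
      have t1: "t \<le> 1"
      proof -
        have "1 - t \<ge> 0" unfolding t(2) using W q ab by simp
        then show ?thesis by simp
      qed
      have qq: "(1 - t) * q1 + t * q2 = 1 / W"
        unfolding t(2) using ab W q by (simp add: t_def add_divide_distrib[symmetric])
      have le1: "q1 \<le> 1" "q2 \<le> 1" using q sale_bounds[OF d] by (meson less_imp_le order_trans)+
      have "concave_on {0..1} (revenue_curve (cdf M))" using reg by (simp add: regular01_def)
      from concave_onD[OF this t(1) t1, of q1 q2]
      have "(1 - t) * revenue_curve (cdf M) q1 + t * revenue_curve (cdf M) q2 \<le> revenue_curve (cdf M) (1 / W)"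
        using q le1 by (simp add: qq)
      moreover have "q1 * x \<le> revenue_curve (cdf M) q1"
        unfolding revenue_curve_def
        using quantile01_ge[OF d, of x q1] q u1 xy by (intro mult_left_mono) auto
      moreover have "q2 * u \<le> revenue_curve (cdf M) q2"
        unfolding revenue_curve_def
        using quantile01_ge[OF d, of u q2] q u1 xy by (intro mult_left_mono) auto
      ultimately have "(1 - t) * (q1 * x) + t * (q2 * u) \<le> revenue_curve (cdf M) (1 / W)"
        using mult_left_mono[of _ _ "1 - t"] mult_left_mono[of _ _ t] t(1) t1
        by (meson add_mono diff_ge_0_iff_ge order_trans)
      also have "(1 - t) * (q1 * x) + t * (q2 * u) = (a * x + b * u) / W"
        unfolding t(2) using q by (simp add: t_def add_divide_distrib)
      also have "\<dots> = y / W" using ab by simp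
      finally have "y \<le> quantile01 (cdf M) (1 - 1 / W)"
        using W by (simp add: revenue_curve_def field_simps)
      then have "1 / W \<le> sale M y"
        using False u1 xy by (intro sale_ge_of_quantile01[OF d]) auto
      moreover have "W = (a / sale M x + b / sale M u) / r"
        by (simp add: W_def q1_def q2_def add_divide_distrib mult.commute)
      ultimately show ?thesis by simp
    qed
    then have "1 / (a / sale M x + b / sale M u) \<le> sale M y"
      by (rule field_le_mult_one_interval)
    moreover have "a / sale M x + b / sale M u > 0" using ab posx pos by (auto intro!: add_pos_pos)
    ultimately have "1 / sale M y \<le> a / sale M x + b / sale M u"
      using posy by (simp add: field_simps)
    then have "(u - x) * (1 / sale M y) \<le> (u - x) * (a / sale M x + b / sale M u)"
      using xy by (intro mult_left_mono) auto
    also have "\<dots> = (u - y) / sale M x + (y - x) / sale M u"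
      using xy by (simp add: a_def b_def distrib_left)
    finally show ?thesis by simp
  qed
qed

text \<open>The shift is only \<open>e / 2\<close>; the other half of the horizontal slack converts
  between \<open>sale\<close> and \<open>cdf\<close> in the presence of atoms.\<close>

lemma levy_leI:
  assumes M: "dist01 M" and M': "dist01 M'" and e: "0 < e"
    and 1: "\<And>v. sale M' v \<le> sale M (v - e / 2) + e"
    and 2: "\<And>v. sale M v \<le> sale M' (v - e / 2) + e"
  shows "levy (cdf M) (cdf M') \<le> ereal e"
proof -
  have "cdf M (v - e) - e \<le> cdf M' v" for v
    using cdf_sale(2)[OF M, of "v - e" "v - e / 2"] cdf_sale(1)[OF M', of v "v + 1"] 1[of v] e
    by simp
  moreover have "cdf M' v \<le> cdf M (v + e) + e" for v
    using cdf_sale(1)[OF M, of "v + e" "v + e + 1"] cdf_sale(2)[OF M', of v "v + e - e / 2"] 2[of "v + e"] e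
    by simp
  ultimately show ?thesis
    unfolding levy_def using e by (intro INF_lower) auto
qed

section \<open>Stability of the chord bounds for sale probabilities\<close>

lemma reciprocal_le:
  fixes a d :: real
  assumes "0 < a" "1 / a \<le> d" shows "0 < 1 / d \<and> 1 / d \<le> a"
proof -
  have "0 < 1 / a" using assms by simp
  with assms have "0 < d" by linarith
  with assms show ?thesis by (simp add: field_simps)
qed

text \<open>\<open>E\<close> is the reciprocal of the line through \<open>1 / Z\<close> at -1 and
  \<open>1 / A\<close> at 0, continued to \<open>t\<close>. Its partial derivatives
  \<open>(1 + t) * (E / A)^2\<close> and \<open>- t * (E / Z)^2\<close> have size at most 2 and 1,
  hence the factor 3; the proof is the finite-difference form of this.\<close>

lemma harmonic_extension_perturb:
  fixes A Z A' Z' t \<delta> E E' :: real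
  assumes A: "0 < A" "A \<le> Z" "0 < A'" "A' \<le> Z'" and t: "0 \<le> t" "t \<le> 1"
    and \<delta>: "\<bar>A - A'\<bar> \<le> \<delta>" "\<bar>Z - Z'\<bar> \<le> \<delta>"
    and E: "E = 1 / ((1 + t) / A - t / Z)" "E' = 1 / ((1 + t) / A' - t / Z')"
  shows "0 < E" "E \<le> A" "\<bar>E' - E\<bar> \<le> 3 * \<delta>"
proof -
  have *: "0 < 1 / ((1 + t) / a - t / z) \<and> 1 / ((1 + t) / a - t / z) \<le> a" if "0 < a" "a \<le> z" for a z :: real
  proof -
    have "t / z \<le> t / a" using that t by (intro divide_left_mono) auto
    then have "1 / a \<le> (1 + t) / a - t / z" by (simp add: add_divide_distrib)
    then show ?thesis using that by (intro reciprocal_le) auto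
  qed
  have 1: "0 < E" "E \<le> A" and 2: "0 < E'" "E' \<le> A'" using * A E by auto
  show "0 < E" "E \<le> A" using 1 by auto
  have i: "1 / E = (1 + t) / A - t / Z" "1 / E' = (1 + t) / A' - t / Z'" using E by auto
  have "E' - E = (1 / E - 1 / E') * (E * E')" using 1 2 by (simp add: field_simps)
  also have "\<dots> = (1 + t) * ((A' - A) * ((E / A) * (E' / A'))) - t * ((Z' - Z) * ((E / Z) * (E' / Z')))"
    unfolding i using A by (simp add: field_simps)
  finally have eq: "E' - E = \<dots>" .
  have ra: "\<bar>(E / A) * (E' / A')\<bar> \<le> 1" using A 1 2 by (auto simp: abs_mult intro!: mult_le_one mult_mono)
  have rz: "\<bar>(E / Z) * (E' / Z')\<bar> \<le> 1" using A 1 2 by (auto simp: abs_mult intro!: mult_le_one mult_mono)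
  have "\<bar>(A' - A) * ((E / A) * (E' / A'))\<bar> \<le> \<delta> * 1"
    unfolding abs_mult[of "A' - A"] using \<delta> ra by (intro mult_mono) auto
  moreover have "\<bar>(Z' - Z) * ((E / Z) * (E' / Z'))\<bar> \<le> \<delta> * 1"
    unfolding abs_mult[of "Z' - Z"] using \<delta> rz by (intro mult_mono) auto
  ultimately have "\<bar>(1 + t) * ((A' - A) * ((E / A) * (E' / A')))\<bar> \<le> 2 * \<delta>"
    "\<bar>t * ((Z' - Z) * ((E / Z) * (E' / Z')))\<bar> \<le> 1 * \<delta>"
    unfolding abs_mult[of "1 + t"] abs_mult[of t] using t by (intro mult_mono; simp)+
  from order_trans[OF abs_triangle_ineq4 add_mono[OF this]] show "\<bar>E' - E\<bar> \<le> 3 * \<delta>"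
    unfolding eq by simp
qed

text \<open>\<open>H\<close> is the reciprocal of the chord of \<open>1 / S\<close>. It may exceed
  \<open>B\<close>, so the ratios \<open>H / B <= 2\<close> and \<open>H' / B' <= 3\<close> enter
  and give \<open>1 + 2 * 3 = 7\<close>; the perturbed pair gets the ratio 3 because errors can
  spoil the factor 2.\<close>

lemma harmonic_mean_perturb:
  fixes A B A' B' t \<delta> H H' :: real
  assumes A: "0 < B" "B \<le> A" "A \<le> 2 * B" "0 < B'" "B' \<le> A'" "A' \<le> 3 * B'" and t: "0 \<le> t" "t \<le> 1"
    and \<delta>: "\<bar>A - A'\<bar> \<le> \<delta>" "\<bar>B - B'\<bar> \<le> \<delta>"
    and H: "H = 1 / ((1 - t) / A + t / B)" "H' = 1 / ((1 - t) / A' + t / B')"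
  shows "0 < H" "H \<le> A" "\<bar>H' - H\<bar> \<le> 7 * \<delta>"
proof -
  have *: "0 < 1 / ((1 - t) / a + t / b) \<and> 1 / ((1 - t) / a + t / b) \<le> a" if "0 < b" "b \<le> a" for a b :: real
  proof -
    have "t / a \<le> t / b" using that t by (intro divide_left_mono) auto
    then have "1 / a \<le> (1 - t) / a + t / b" by (simp add: diff_divide_distrib)
    then show ?thesis using that by (intro reciprocal_le) auto
  qed
  have 1: "0 < H" "H \<le> A" and 2: "0 < H'" "H' \<le> A'" using * A H by auto
  show "0 < H" "H \<le> A" using 1 by auto
  have i: "1 / H = (1 - t) / A + t / B" "1 / H' = (1 - t) / A' + t / B'" using H by auto
  have pos: "A > 0" "A' > 0" using A by auto
  have "H' - H = (1 / H - 1 / H') * (H * H')" using 1 2 by (simp add: field_simps)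
  also have "\<dots> = (1 - t) * ((A' - A) * ((H / A) * (H' / A'))) + t * ((B' - B) * ((H / B) * (H' / B')))"
    unfolding i using A pos by (simp add: field_simps)
  finally have eq: "H' - H = \<dots>" .
  have ra: "\<bar>(H / A) * (H' / A')\<bar> \<le> 1" using A 1 2 by (auto simp: abs_mult intro!: mult_le_one mult_mono)
  have "H / B \<le> 2" "H' / B' \<le> 3" using A 1 2 by (auto simp: divide_le_eq)
  then have rb: "\<bar>(H / B) * (H' / B')\<bar> \<le> 2 * 3"
    unfolding abs_mult using A 1 2 by (intro mult_mono) auto
  have "\<bar>(A' - A) * ((H / A) * (H' / A'))\<bar> \<le> \<delta> * 1"
    unfolding abs_mult[of "A' - A"] using \<delta> ra by (intro mult_mono) auto
  moreover have "\<bar>(B' - B) * ((H / B) * (H' / B'))\<bar> \<le> \<delta> * 6"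
    unfolding abs_mult[of "B' - B"] using \<delta> rb by (intro mult_mono) auto
  ultimately have "\<bar>(1 - t) * ((A' - A) * ((H / A) * (H' / A')))\<bar> \<le> 1 * \<delta>"
    "\<bar>t * ((B' - B) * ((H / B) * (H' / B')))\<bar> \<le> 1 * (\<delta> * 6)"
    unfolding abs_mult[of "1 - t"] abs_mult[of t] using t by (intro mult_mono; simp)+
  from order_trans[OF abs_triangle_ineq add_mono[OF this]] show "\<bar>H' - H\<bar> \<le> 7 * \<delta>"
    unfolding eq by simp
qed

text \<open>Each of \<open>s\<close>, \<open>s'\<close> lies between its chord and extension bounds.
  Those for \<open>s\<close> differ by \<open>t * D * E * H <= D * A^2\<close>, where
  \<open>D\<close> is the second difference of \<open>1 / S\<close>; the factor \<open>A^2\<close>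
  converts a gap in \<open>1 / S\<close> into one in \<open>S\<close>.\<close>

lemma harmonic_sandwich_gap:
  fixes A B Z A' B' Z' s s' t e :: real
  assumes e: "0 < e" and t: "0 \<le> t" "t \<le> 1"
    and A: "0 < B" "B \<le> A" "A \<le> Z" "B' \<le> A'" "A' \<le> Z'"
    and big: "e / 4 < A" "A / 2 \<le> B"
    and curv: "0 \<le> 1 / B - 2 / A + 1 / Z" "(1 / B - 2 / A + 1 / Z) * A\<^sup>2 \<le> e / 4"
    and \<delta>: "\<bar>A - A'\<bar> \<le> e / 100" "\<bar>B - B'\<bar> \<le> e / 100" "\<bar>Z - Z'\<bar> \<le> e / 100"
    and s: "0 < s" "0 < s'"
    and up: "1 / s \<le> (1 - t) / A + t / B" "1 / s' \<le> (1 - t) / A' + t / B'"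
    and lo: "(1 + t) / A \<le> 1 / s + t / Z" "(1 + t) / A' \<le> 1 / s' + t / Z'"
  shows "\<bar>s - s'\<bar> \<le> e / 2"
proof -
  define E where "E = 1 / ((1 + t) / A - t / Z)"
  define E' where "E' = 1 / ((1 + t) / A' - t / Z')"
  define H where "H = 1 / ((1 - t) / A + t / B)"
  define H' where "H' = 1 / ((1 - t) / A' + t / B')"
  \<comment> \<open>\<open>B > e / 8\<close> is large against the errors \<open>e / 100\<close>, so
    the factor 2 degrades to at most 3.\<close>
  have B': "0 < B'" "A' \<le> 3 * B'" using big \<delta> e by linarith+
  then have A': "0 < A'" using A by linarith
  have A0: "0 < A" using A by linarith
  have "A \<le> 2 * B" using big by simp
  note E = harmonic_extension_perturb[OF A0 A(3) A' A(5) t \<delta>(1) \<delta>(3) E_def E'_def]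
  note E2 = harmonic_extension_perturb[OF A' A(5) A0 A(3) t _ _ E'_def E_def, of "e/100"]
  note H = harmonic_mean_perturb[OF A(1,2) \<open>A \<le> 2 * B\<close> B'(1) A(4) B'(2) t \<delta>(1) \<delta>(2) H_def H'_def]
  have E'0: "0 < E'" using E2 \<delta> by (simp add: abs_minus_commute)
  have Hb: "0 < (1 - t) / A + t / B" using H(1) by (simp add: H_def)
  have s_le: "s \<le> E" "s' \<le> E'"
  proof -
    have "1 / E \<le> 1 / s" "1 / E' \<le> 1 / s'" using lo by (auto simp: E_def E'_def)
    then show "s \<le> E" "s' \<le> E'" using s E(1) E'0 by (auto simp: field_simps)
  qed
  have H'0: "0 < H'"
  proof -
    have "0 < 1 / s'" using s by simp
    also have "\<dots> \<le> 1 / H'" using up by (simp add: H'_def)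
    finally show ?thesis by simp
  qed
  have s_ge: "H \<le> s" "H' \<le> s'"
  proof -
    have "1 / s \<le> 1 / H" "1 / s' \<le> 1 / H'" using up by (auto simp: H_def H'_def)
    then show "H \<le> s" "H' \<le> s'" using s H(1) H'0 by (auto simp: field_simps)
  qed
  define D where "D = 1 / B - 2 / A + 1 / Z"
  have "1 / H - 1 / E = t * D" by (simp add: H_def E_def D_def algebra_simps diff_divide_distrib add_divide_distrib)
  moreover have "E - H = (1 / H - 1 / E) * (E * H)" using E(1) H(1) by (simp add: field_simps)
  ultimately have "E - H = (t * D) * (E * H)" by simp
  also have "\<dots> \<le> (1 * D) * (A * A)"
    using E H t curv(1)[folded D_def] by (intro mult_mono mult_nonneg_nonneg) auto
  also have "\<dots> \<le> e / 4" using curv(2) by (simp add: D_def power2_eq_square)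
  finally have "E - H \<le> e / 4" .
  with s_le s_ge E(3) H(3) e show ?thesis by linarith
qed

section \<open>Three prices determine a flat interval\<close>

lemma inverse_sale_convex':
  assumes "regular01 M" "x \<le> y" "y \<le> u" "0 < sale M u"
  shows "(u - x) / sale M y \<le> (u - y) / sale M x + (y - x) / sale M u"
  using inverse_sale_convex[of M x y u] assms by (cases "x = y \<or> y = u") auto

text \<open>Sale probabilities up to \<open>e / 4\<close> are left out, since monotonicity alone
  locates them. For positive \<open>e\<close>, a vanishing \<open>S\<close> at \<open>a + w\<close>
  falls under the halving condition, so the value of \<open>1 / 0\<close> never decides.\<close>

definition curved :: "real measure \<Rightarrow> real \<Rightarrow> real \<Rightarrow> real \<Rightarrow> bool" where
  "curved M e w a \<longleftrightarrow> e / 4 < sale M a \<and>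
     (sale M (a + w) < sale M a / 2 \<or>
      e / 4 < (1 / sale M (a + w) - 2 / sale M a + 1 / sale M (a - w)) * (sale M a)\<^sup>2)"

lemma second_difference_nonneg:
  assumes "regular01 M" "0 < w" "0 < sale M (a + w)"
  shows "0 \<le> 1 / sale M (a + w) - 2 / sale M a + 1 / sale M (a - w)"
proof -
  have "(2 * w) / sale M a \<le> w / sale M (a - w) + w / sale M (a + w)"
    using inverse_sale_convex[of M "a - w" a "a + w"] assms by simp
  then have "0 \<le> w * (1 / sale M (a + w) - 2 / sale M a + 1 / sale M (a - w))"
    by (simp add: algebra_simps)
  then show ?thesis using assms by (simp add: zero_le_mult_iff)
qed

text \<open>Only \<open>M\<close> has to be flat: \<open>M'\<close> enters through its values at the
  three prices and its own convexity. Thus flatness of the unknown true distribution certifies an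
  interval against every competitor.\<close>

lemma sale_close:
  assumes reg: "regular01 M" "regular01 M'" and e: "0 < e" and w: "0 < w"
    and flat: "\<not> curved M e w a"
    and near: "\<And>x. x \<in> {a - w, a, a + w} \<Longrightarrow> \<bar>sale M x - sale M' x\<bar> \<le> e / 100"
    and v: "a \<le> v" "v \<le> a + w"
  shows "\<bar>sale M v - sale M' v\<bar> \<le> e / 2"
proof -
  have d: "dist01 M" "dist01 M'" using reg by (auto intro: regular01_dist01)
  show ?thesis
  proof (cases "sale M a \<le> e / 4")
    case True
    have "sale M v \<le> sale M a" "sale M' v \<le> sale M' a" using sale_antimono d v by auto
    moreover have "\<bar>sale M a - sale M' a\<bar> \<le> e / 100" using near by simp
    ultimately show ?thesis
      using True sale_bounds(1)[OF d(1), of v] sale_bounds(1)[OF d(2), of v] e by linarith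
  next
    case False
    with flat have AB: "e / 4 < sale M a" "sale M a / 2 \<le> sale M (a + w)"
      and cu: "(1 / sale M (a + w) - 2 / sale M a + 1 / sale M (a - w)) * (sale M a)\<^sup>2 \<le> e / 4"
      by (auto simp: curved_def)
    have "\<bar>sale M (a + w) - sale M' (a + w)\<bar> \<le> e / 100" using near by simp
    then have B: "0 < sale M (a + w)" "0 < sale M' (a + w)" using AB e by linarith+
    have pv: "0 < sale M v" "0 < sale M' v"
      using B sale_antimono[OF d(1) v(2)] sale_antimono[OF d(2) v(2)] by auto
    define t where "t = (v - a) / w"
    have t: "0 \<le> t" "t \<le> 1" and vt: "v = a + t * w" using v w by (auto simp: t_def)
    have up: "1 / sale K v \<le> (1 - t) / sale K a + t / sale K (a + w)"
      if "regular01 K" "0 < sale K (a + w)" for K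
    proof -
      have "w * (1 / sale K v) \<le> w * ((1 - t) / sale K a + t / sale K (a + w))"
        using inverse_sale_convex'[OF that(1) v that(2)] by (simp add: vt algebra_simps)
      then show ?thesis using w mult_le_cancel_left_pos by blast
    qed
    have lo: "(1 + t) / sale K a \<le> 1 / sale K v + t / sale K (a - w)"
      if "regular01 K" "0 < sale K v" for K
    proof -
      have "w * ((1 + t) / sale K a) \<le> w * (1 / sale K v + t / sale K (a - w))"
        using inverse_sale_convex'[OF that(1) _ v(1) that(2), of "a - w"] w by (simp add: vt algebra_simps)
      then show ?thesis using w mult_le_cancel_left_pos by blast
    qed
    show ?thesis
      by (rule harmonic_sandwich_gap[OF e t B(1) _ _ _ _ AB second_difference_nonneg[OF reg(1) w B(1)] cu
            _ _ _ pv up[OF reg(1) B(1)] up[OF reg(2) B(2)] lo[OF reg(1) pv(1)] lo[OF reg(2) pv(2)]])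
        (use sale_antimono d w near in auto)
  qed
qed

section \<open>Counting the curved intervals of one level\<close>

lemma sum_increments_le:
  fixes p :: "nat \<Rightarrow> real"
  assumes "finite T" "T \<noteq> {}" "\<And>k. k \<le> Max T \<Longrightarrow> p k \<le> p (Suc k)"
  shows "(\<Sum>k\<in>T. p (Suc k) - p k) \<le> p (Suc (Max T)) - p (Min T)"
proof -
  have "(\<Sum>k\<in>T. p (Suc k) - p k) \<le> (\<Sum>k\<in>{Min T..Max T}. p (Suc k) - p k)"
    using assms by (intro sum_mono2) auto
  also have "\<dots> = p (Suc (Max T)) - p (Min T)"
    using assms by (intro sum_Suc_diff) (simp add: le_SucI)
  finally show ?thesis .
qed

lemma dyadic_class:
  fixes s :: real
  assumes "1 / 2 ^ J < s" "s \<le> 1"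
  shows "\<exists>j<J. 1 / 2 ^ Suc j < s \<and> s \<le> 1 / 2 ^ j"
  using assms
proof (induction J)
  case (Suc J)
  show ?case
  proof (cases "1 / 2 ^ J < s")
    case True
    then show ?thesis using Suc less_Suc_eq by blast
  next
    case False
    then show ?thesis using Suc.prems by (intro exI[of _ J]) auto
  qed
qed auto

text \<open>On one dyadic class of sale probabilities, split by the increment \<open>d\<close> of the reciprocal:
  few intervals have a large \<open>d\<close> since the increments sum up to at most the range, and few have a small
  \<open>d\<close> since \<open>d\<close> is monotone and grows by a fixed amount on every curved interval.\<close>
lemma card_curved_class:
  fixes n j :: nat
  assumes reg: "regular01 M" and e: "0 < e" and w: "0 < w"
  defines "T \<equiv> {k. k < n \<and> curved M e w (real k * w) \<and>
      1 / 2 ^ Suc j < sale M (real k * w) \<and> sale M (real k * w) \<le> 1 / 2 ^ j}"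
  shows "real (card T) \<le> 1 + 8 / sqrt e"
proof -
  have d: "dist01 M" using reg by (rule regular01_dist01)
  have anti: "sale M y \<le> sale M x" if "x \<le> y" for x y using sale_antimono[OF d that] .
  define g where "g k = 1 / sale M (real k * w)" for k
  define q where "q k = g k - 1 / sale M (real k * w - w)" for k
  have qS: "q (Suc k) = g (Suc k) - g k" for k by (simp add: q_def g_def algebra_simps)
  define T1 where "T1 = {k \<in> T. sale M (real k * w + w) < sale M (real k * w) / 2}"
  define T2 where "T2 = {k \<in> T. sale M (real k * w) / 2 \<le> sale M (real k * w + w)}"
  have fin: "finite T" "finite T1" "finite T2" by (auto simp: T_def T1_def T2_def)
  have "T = T1 \<union> T2" by (auto simp: T1_def T2_def)
  \<comment> \<open>Halving leaves the dyadic class, so it happens at most once.\<close>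
  have "card T1 \<le> Suc 0"
  proof -
    have False if "k \<in> T1" "k' \<in> T1" "k < k'" for k k'
    proof -
      have "real k + 1 \<le> real k'" using that by simp
      then have "real k * w + w \<le> real k' * w"
        using mult_right_mono[of "real k + 1" "real k'" w] w by (simp add: algebra_simps)
      then have "sale M (real k' * w) \<le> sale M (real k * w + w)" by (rule anti)
      also have "\<dots> < sale M (real k * w) / 2" using that by (simp add: T1_def)
      also have "\<dots> \<le> 1 / 2 ^ j / 2" using that by (intro divide_right_mono) (auto simp: T1_def T_def)
      also have "\<dots> < sale M (real k' * w)" using that by (simp add: T1_def T_def)
      finally show False .
    qed
    then show ?thesis
      unfolding card_le_Suc0_iff_eq[OF fin(2)] by (metis linorder_neqE_nat)
  qed
  \<comment> \<open>Up to the last element of \<open>T2\<close> the sale probability is positive;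
    behind it \<open>1 / 0 = 0\<close> may destroy the monotonicity of \<open>g\<close> and
    \<open>q\<close>.\<close>
  have pos2: "0 < sale M (real k * w + w)" if "k \<le> i" "i \<in> T2" for i k
  proof -
    have "real k * w \<le> real i * w" using that w by (intro mult_right_mono) auto
    then have "sale M (real i * w + w) \<le> sale M (real k * w + w)" by (intro anti) simp
    moreover have "0 < sale M (real i * w)" using that e by (auto simp: T2_def T_def curved_def)
    ultimately show ?thesis using that by (auto simp: T2_def)
  qed
  have gmono: "g k \<le> g (Suc k)" and qmono: "q k \<le> q (Suc k)" if "k \<le> i" "i \<in> T2" for i k
  proof -
    have p: "0 < sale M (real k * w + w)" using pos2 that by blast
    moreover have "sale M (real k * w + w) \<le> sale M (real k * w)" using anti w by simp
    ultimately show "g k \<le> g (Suc k)"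
      unfolding g_def by (intro divide_left_mono) (auto simp: algebra_simps)
    show "q k \<le> q (Suc k)"
      using second_difference_nonneg[OF reg w p] unfolding qS by (simp add: g_def q_def algebra_simps)
  qed
  have qpos: "0 \<le> q k" if "k \<le> i" "i \<in> T2" for i k
  proof -
    have p: "0 < sale M (real k * w + w)" using pos2 that by blast
    moreover have "sale M (real k * w + w) \<le> sale M (real k * w)" "sale M (real k * w) \<le> sale M (real k * w - w)"
      using anti w by simp_all
    ultimately show ?thesis
      unfolding g_def q_def by (simp add: frac_le)
  qed
  have g_nonneg: "0 \<le> g k" for k using sale_bounds[OF d] by (simp add: g_def)
  \<comment> \<open>\<open>S\<close> exceeds \<open>1 / 2 ^ Suc j\<close> on the class and at most
    halves in this step.\<close>
  have gle: "g (Suc i) \<le> 4 * 2 ^ j" if "i \<in> T2" for i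
  proof -
    have "1 / 2 ^ Suc j / 2 < sale M (real i * w + w)" using that by (auto simp: T2_def T_def)
    then have "1 / sale M (real i * w + w) < 1 / (1 / 2 ^ Suc j / 2)"
      using pos2[OF order_refl that] by (intro divide_strict_left_mono) auto
    then show ?thesis by (simp add: g_def algebra_simps)
  qed
  have Dbig: "e / 4 * (2 ^ j * 2 ^ j) \<le> q (Suc i) - q i" if "i \<in> T2" for i
  proof -
    let ?A = "sale M (real i * w)"
    have "q (Suc i) - q i = 1 / sale M (real i * w + w) - 2 / ?A + 1 / sale M (real i * w - w)"
      unfolding qS by (simp add: g_def q_def algebra_simps)
    then have "e / 4 < (q (Suc i) - q i) * ?A\<^sup>2"
      using that by (auto simp: T2_def T_def curved_def)
    also have "\<dots> \<le> (q (Suc i) - q i) * (1 / 2 ^ j)\<^sup>2"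
      using that qmono[OF order_refl that] sale_bounds[OF d]
      by (intro mult_left_mono power_mono) (auto simp: T2_def T_def)
    finally show ?thesis by (simp add: power2_eq_square field_simps)
  qed
  \<comment> \<open>The range \<open>4 * 2 ^ j\<close> of \<open>g\<close> over the threshold gives
    \<open>4 / sqrt e\<close> for \<open>Hi\<close>; the threshold over the growth
    \<open>e / 4 * 4 ^ j\<close> of \<open>q\<close> gives \<open>4 / (sqrt e * 2 ^ j)\<close> for
    \<open>Lo\<close>. The width \<open>w\<close> does not enter, so every level has the same
    bound.\<close>
  define \<theta> where "\<theta> = sqrt e * 2 ^ j"
  have \<theta>: "\<theta> > 0" using e by (simp add: \<theta>_def)
  define Hi where "Hi = {k \<in> T2. \<theta> < q (Suc k)}"
  define Lo where "Lo = {k \<in> T2. q (Suc k) \<le> \<theta>}"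
  have "real (card Hi) \<le> 4 / sqrt e"
  proof (cases "Hi = {}")
    case False
    have fH: "finite Hi" using fin by (simp add: Hi_def)
    then have mx: "Max Hi \<in> T2" "Min Hi \<in> T2" using Max_in[OF fH False] Min_in[OF fH False] by (auto simp: Hi_def)
    have "real (card Hi) * \<theta> \<le> (\<Sum>k\<in>Hi. g (Suc k) - g k)"
      unfolding qS[symmetric] by (rule sum_bounded_below) (auto simp: Hi_def)
    also have "\<dots> \<le> g (Suc (Max Hi)) - g (Min Hi)"
      using sum_increments_le[OF fH False, of g] gmono mx by blast
    also have "\<dots> \<le> 4 * 2 ^ j" using gle[OF mx(1)] g_nonneg[of "Min Hi"] by linarith
    finally show ?thesis using e by (simp add: \<theta>_def field_simps)
  qed (use e in simp)
  have "real (card Lo) \<le> 4 / sqrt e"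
  proof (cases "Lo = {}")
    case False
    have fL: "finite Lo" using fin by (simp add: Lo_def)
    then have mx: "Max Lo \<in> Lo" "Min Lo \<in> T2" "Max Lo \<in> T2"
      using Max_in[OF fL False] Min_in[OF fL False] by (auto simp: Lo_def)
    have "real (card Lo) * (e / 4 * (2 ^ j * 2 ^ j)) \<le> (\<Sum>k\<in>Lo. q (Suc k) - q k)"
      by (rule sum_bounded_below) (use Dbig in \<open>auto simp: Lo_def\<close>)
    also have "\<dots> \<le> q (Suc (Max Lo)) - q (Min Lo)"
      using sum_increments_le[OF fL False, of q] qmono mx by blast
    also have "\<dots> \<le> \<theta>" using mx qpos[OF order_refl mx(2)] by (simp add: Lo_def)
    finally have "real (card Lo) * (e * 2 ^ j) \<le> 4 * sqrt e"
      by (simp add: \<theta>_def field_simps)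
    moreover have "real (card Lo) * (e * 1) \<le> real (card Lo) * (e * 2 ^ j)"
      using e by (intro mult_left_mono) auto
    moreover have "real (card Lo) * (e * 1) = sqrt e * (real (card Lo) * sqrt e)" using e by simp
    ultimately have "sqrt e * (real (card Lo) * sqrt e) \<le> sqrt e * 4" by linarith
    then have "real (card Lo) * sqrt e \<le> 4" using e by (simp only: mult_le_cancel_left_pos real_sqrt_gt_zero)
    then show ?thesis using e by (simp add: pos_le_divide_eq)
  qed (use e in simp)
  moreover have "card T \<le> card T1 + (card Hi + card Lo)"
  proof -
    have "T2 = Hi \<union> Lo" by (auto simp: Hi_def Lo_def)
    then have "card T2 \<le> card Hi + card Lo" using card_Un_le by metis
    then show ?thesis using card_Un_le[of T1 T2] \<open>T = T1 \<union> T2\<close> by simp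
  qed
  ultimately show ?thesis using \<open>card T1 \<le> Suc 0\<close> \<open>real (card Hi) \<le> 4 / sqrt e\<close> by linarith
qed

lemma card_curved:
  assumes reg: "regular01 M" and e: "0 < e" and w: "0 < w" and J: "1 / 2 ^ J \<le> e / 4"
  shows "real (card {k. k < n \<and> curved M e w (real k * w)}) \<le> real J * (1 + 8 / sqrt e)"
proof -
  define T where "T j = {k. k < n \<and> curved M e w (real k * w) \<and>
      1 / 2 ^ Suc j < sale M (real k * w) \<and> sale M (real k * w) \<le> 1 / 2 ^ j}" for j :: nat
  have "{k. k < n \<and> curved M e w (real k * w)} \<subseteq> (\<Union>j<J. T j)"
  proof
    fix k assume k: "k \<in> {k. k < n \<and> curved M e w (real k * w)}"
    then have "1 / 2 ^ J < sale M (real k * w)" using J by (auto simp: curved_def)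
    from dyadic_class[OF this sale_bounds(2)[OF regular01_dist01[OF reg]]] k
    show "k \<in> (\<Union>j<J. T j)" by (auto simp: T_def)
  qed
  then have "card {k. k < n \<and> curved M e w (real k * w)} \<le> card (\<Union>j<J. T j)"
    by (intro card_mono) (auto simp: T_def)
  also have "\<dots> \<le> (\<Sum>j<J. card (T j))" by (rule card_UN_le) simp
  finally have "real (card {k. k < n \<and> curved M e w (real k * w)}) \<le> (\<Sum>j<J. real (card (T j)))"
    by (metis of_nat_mono of_nat_sum)
  also have "\<dots> \<le> (\<Sum>j<J. 1 + 8 / sqrt e)"
    unfolding T_def by (intro sum_mono card_curved_class[OF reg e w])
  finally show ?thesis by simp
qed

section \<open>Repeated queries\<close>

lemma exp_le_quadratic:
  fixes x :: real
  assumes "\<bar>x\<bar> \<le> 1" shows "exp x \<le> 1 + x + x\<^sup>2"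
proof (cases "0 \<le> x")
  case True
  then show ?thesis using assms exp_bound by simp
next
  case False
  define y where "y = - x"
  have y: "0 \<le> y" using False by (simp add: y_def)
  have "1 \<le> (1 + y) * (1 - y + y\<^sup>2)"
    using y by (simp add: algebra_simps power2_eq_square)
  also have "\<dots> \<le> exp y * (1 - y + y\<^sup>2)"
  proof (rule mult_right_mono)
    show "0 \<le> 1 - y + y\<^sup>2" using assms y by (simp add: y_def)
  qed (use y in simp)
  finally have "exp (- y) * 1 \<le> exp (- y) * (exp y * (1 - y + y\<^sup>2))" by (intro mult_left_mono) auto
  also have "\<dots> = 1 - y + y\<^sup>2" by (simp add: mult.assoc[symmetric] flip: exp_add)
  finally show ?thesis by (simp add: y_def)
qed

definition bernoulli_weight :: "real \<Rightarrow> bool list \<Rightarrow> real" where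
  "bernoulli_weight s h = prod_list (map (\<lambda>b. if b then s else 1 - s) h)"

definition bit_sum :: "bool list \<Rightarrow> real" where
  "bit_sum h = sum_list (map of_bool h)"

text \<open>The moment generating function of the centred number of sales; at \<open>l = 0\<close>
  it also yields total mass 1.\<close>

lemma sum_bernoulli_weight_exp:
  "(\<Sum>h | length h = N. bernoulli_weight s h * exp (l * (bit_sum h - real N * s)))
    = (s * exp (l * (1 - s)) + (1 - s) * exp (- l * s)) ^ N"
proof (induction N)
  case (Suc N)
  have "bernoulli_weight s (h @ [True]) * exp (l * (bit_sum (h @ [True]) - real (Suc N) * s))
      + bernoulli_weight s (h @ [False]) * exp (l * (bit_sum (h @ [False]) - real (Suc N) * s))
    = bernoulli_weight s h * exp (l * (bit_sum h - real N * s)) * (s * exp (l * (1 - s)) + (1 - s) * exp (- l * s))" for h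
  proof -
    have 1: "l * (bit_sum h + 1 - real (Suc N) * s) = l * (bit_sum h - real N * s) + l * (1 - s)"
      "l * (bit_sum h - real (Suc N) * s) = l * (bit_sum h - real N * s) + - l * s"
      by (simp_all add: algebra_simps)
    have 2: "bernoulli_weight s (h @ [True]) = bernoulli_weight s h * s"
      "bernoulli_weight s (h @ [False]) = bernoulli_weight s h * (1 - s)"
      "bit_sum (h @ [True]) = bit_sum h + 1" "bit_sum (h @ [False]) = bit_sum h"
      by (simp_all add: bernoulli_weight_def bit_sum_def)
    show ?thesis unfolding 2 1 exp_add by (simp add: distrib_left mult.assoc mult.left_commute)
  qed
  then show ?case
    unfolding sum_lists_Suc using Suc by (simp add: sum_distrib_right[symmetric] mult.commute)
qed (simp add: bernoulli_weight_def bit_sum_def)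

lemma bernoulli_mgf_le:
  fixes s l :: real
  assumes s: "0 \<le> s" "s \<le> 1" and l: "\<bar>l\<bar> \<le> 1"
  shows "s * exp (l * (1 - s)) + (1 - s) * exp (- l * s) \<le> exp (l\<^sup>2)"
proof -
  have "\<bar>l * (1 - s)\<bar> \<le> 1" "\<bar>- l * s\<bar> \<le> 1"
    using s l by (auto simp: abs_mult intro!: mult_le_one)
  then have "s * exp (l * (1 - s)) + (1 - s) * exp (- l * s)
      \<le> s * (1 + l * (1 - s) + (l * (1 - s))\<^sup>2) + (1 - s) * (1 + - l * s + (- l * s)\<^sup>2)"
    using s by (intro add_mono mult_left_mono exp_le_quadratic) auto
  also have "\<dots> = 1 + l\<^sup>2 * (s * (1 - s))" by (simp add: power2_eq_square algebra_simps)
  also have "\<dots> \<le> 1 + l\<^sup>2 * 1" using s by (intro add_left_mono mult_left_mono) (auto intro: mult_le_one)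
  also have "\<dots> \<le> exp (l\<^sup>2)" using exp_ge_add_one_self[of "l\<^sup>2"] by simp
  finally show ?thesis .
qed

lemma bernoulli_weight_nonneg:
  assumes "0 \<le> s" "s \<le> 1" shows "0 \<le> bernoulli_weight s h"
  unfolding bernoulli_weight_def using assms by (intro prod_list_nonneg) auto

definition freq :: "bool list \<Rightarrow> real" where
  "freq h = bit_sum h / real (length h)"

lemma bernoulli_tail:
  fixes s r :: real
  assumes s: "0 \<le> s" "s \<le> 1" and r: "0 < r" "r \<le> 1" and N: "0 < N"
  shows "(\<Sum>h | length h = N. if \<bar>s - freq h\<bar> \<le> r then 0 else bernoulli_weight s h)
    \<le> 2 * exp (- real N * r\<^sup>2 / 4)"
proof -
  let ?D = "\<lambda>h. bit_sum h - real N * s"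
  have one: "(\<Sum>h | length h = N. bernoulli_weight s h * exp (l * ?D h - \<bar>l\<bar> * (real N * r)))
      \<le> exp (- real N * r\<^sup>2 / 4)" if l: "\<bar>l\<bar> = r / 2" for l
  proof -
    have "(\<Sum>h | length h = N. bernoulli_weight s h * exp (l * ?D h - \<bar>l\<bar> * (real N * r)))
        = (s * exp (l * (1 - s)) + (1 - s) * exp (- l * s)) ^ N * exp (- \<bar>l\<bar> * (real N * r))"
      unfolding sum_bernoulli_weight_exp[symmetric] sum_distrib_right
      by (simp add: mult.assoc flip: exp_add)
    also have "\<dots> \<le> exp (l\<^sup>2) ^ N * exp (- \<bar>l\<bar> * (real N * r))"
      using s l r by (intro mult_right_mono power_mono bernoulli_mgf_le) auto
    also have "\<dots> = exp (real N * l\<^sup>2 - \<bar>l\<bar> * (real N * r))"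
      by (simp flip: exp_of_nat_mult exp_add)
    also have "real N * l\<^sup>2 - \<bar>l\<bar> * (real N * r) = - real N * r\<^sup>2 / 4"
      unfolding power2_abs[symmetric, of l] l by (simp add: power2_eq_square field_simps)
    finally show ?thesis .
  qed
  \<comment> \<open>Markov's inequality for both signs: on the bad event the exponent for
    \<open>l = r / 2\<close> or for \<open>l = - r / 2\<close> is nonnegative. These values minimise
    \<open>l^2 - abs l * r\<close>.\<close>
  have "(\<Sum>h | length h = N. if \<bar>s - freq h\<bar> \<le> r then 0 else bernoulli_weight s h)
     \<le> (\<Sum>h | length h = N. bernoulli_weight s h * exp ((r / 2) * ?D h - \<bar>r / 2\<bar> * (real N * r))
         + bernoulli_weight s h * exp ((- r / 2) * ?D h - \<bar>- r / 2\<bar> * (real N * r)))"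
  proof (rule sum_mono)
    fix h :: "bool list" assume "h \<in> {h. length h = N}"
    then have len: "length h = N" by simp
    let ?w = "bernoulli_weight s h"
    let ?a = "(r / 2) * ?D h - \<bar>r / 2\<bar> * (real N * r)"
    let ?b = "(- r / 2) * ?D h - \<bar>- r / 2\<bar> * (real N * r)"
    have w: "0 \<le> ?w" using s by (rule bernoulli_weight_nonneg)
    show "(if \<bar>s - freq h\<bar> \<le> r then 0 else ?w) \<le> ?w * exp ?a + ?w * exp ?b"
    proof (cases "\<bar>s - freq h\<bar> \<le> r")
      case False
      have D: "?D h = real N * (freq h - s)" using N len by (simp add: freq_def field_simps)
      have "0 \<le> ?a \<or> 0 \<le> ?b"
      proof (cases "freq h \<ge> s")
        case True
        then have "real N * r \<le> ?D h" unfolding D using False by (intro mult_left_mono) auto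
        then have "(r / 2) * (real N * r) \<le> (r / 2) * ?D h" using r by (intro mult_left_mono) auto
        then show ?thesis using r by simp
      next
        case False2: False
        then have "real N * r \<le> real N * (s - freq h)" using False by (intro mult_left_mono) auto
        also have "\<dots> = - ?D h" unfolding D by (simp add: algebra_simps)
        finally have "(r / 2) * (real N * r) \<le> (r / 2) * - ?D h" using r by (intro mult_left_mono) auto
        moreover have "(- r / 2) * ?D h = (r / 2) * - ?D h" "\<bar>- r / 2\<bar> = r / 2"
          using r by (auto simp: algebra_simps)
        ultimately have "0 \<le> ?b" by (simp only: diff_ge_0_iff_ge)
        then show ?thesis by blast
      qed
      then have "1 \<le> exp ?a \<or> 1 \<le> exp ?b" by simp
      then have "1 \<le> exp ?a + exp ?b" by (metis add.commute add_increasing2 exp_ge_zero)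
      then have "?w * 1 \<le> ?w * (exp ?a + exp ?b)" using w by (rule mult_left_mono)
      then show ?thesis using False by (simp add: distrib_left)
    qed (use w in \<open>simp add: add_nonneg_nonneg\<close>)
  qed
  also have "\<dots> \<le> exp (- real N * r\<^sup>2 / 4) + exp (- real N * r\<^sup>2 / 4)"
    unfolding sum.distrib using r by (intro add_mono one) auto
  finally show ?thesis by simp
qed

text \<open>Only the first \<open>j * N\<close> bits are read, so the price of a block depends on
  completed blocks alone. The newest pair stands in front.\<close>

primrec block_data :: "((real \<times> real) list \<Rightarrow> real) \<Rightarrow> nat \<Rightarrow> nat \<Rightarrow> bool list \<Rightarrow> (real \<times> real) list" where
  "block_data nq N 0 h = []"
| "block_data nq N (Suc j) h =
     (nq (block_data nq N j h), freq (take N (drop (j * N) h))) # block_data nq N j h"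

text \<open>The division counts completed blocks, which keeps the price constant throughout a
  block.\<close>

definition block_price :: "((real \<times> real) list \<Rightarrow> real) \<Rightarrow> nat \<Rightarrow> bool list \<Rightarrow> real" where
  "block_price nq N h = nq (block_data nq N (length h div N) h)"

definition accurate :: "real measure \<Rightarrow> real \<Rightarrow> (real \<times> real) list \<Rightarrow> bool" where
  "accurate M r D \<longleftrightarrow> (\<forall>(x, g) \<in> set D. \<bar>sale M x - g\<bar> \<le> r)"

lemma block_data_append: "j * N \<le> length h1 \<Longrightarrow> block_data nq N j (h1 @ h2) = block_data nq N j h1"
  by (induction j) auto

lemma hist_prob_const:
  assumes "dist01 M" "\<And>t. length t < length h \<Longrightarrow> P t = x"
  shows "hist_prob M P h = bernoulli_weight (sale M x) h"
  using assms(2)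
proof (induction h rule: rev_induct)
  case (snoc b h)
  then show ?case by (simp add: hist_prob_snoc[OF assms(1)] bernoulli_weight_def)
qed (simp add: hist_prob_Nil bernoulli_weight_def)

lemma block_price_block:
  assumes "length h1 = j * N" "length t < N"
  shows "block_price nq N (h1 @ t) = nq (block_data nq N j h1)"
proof -
  have "length (h1 @ t) div N = j"
    using assms by (intro div_nat_eqI) (auto simp: algebra_simps)
  then show ?thesis unfolding block_price_def using assms by (simp add: block_data_append)
qed

text \<open>A union bound along the tree of histories: given the completed blocks, the next price is
  fixed and its bits are independent Bernoulli, so each block loses at most the tail probability
  despite the adaptivity.\<close>

lemma prob_accurate:
  assumes M: "dist01 M" and r: "0 < r" "r \<le> 1" and N: "0 < N"
  shows "1 - real j * (2 * exp (- real N * r\<^sup>2 / 4))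
    \<le> (\<Sum>h | length h = j * N. hist_prob M (block_price nq N) h * of_bool (accurate M r (block_data nq N j h)))"
proof (induction j)
  case (Suc j)
  let ?P = "block_price nq N" and ?\<delta> = "2 * exp (- real N * r\<^sup>2 / 4)"
  let ?x = "\<lambda>h1. nq (block_data nq N j h1)"
  let ?G = "\<lambda>h1. of_bool (accurate M r (block_data nq N j h1)) :: real"
  have "1 - real (Suc j) * ?\<delta>
      \<le> (\<Sum>h | length h = j * N. hist_prob M ?P h * ?G h) - (\<Sum>h | length h = j * N. hist_prob M ?P h) * ?\<delta>"
    using Suc unfolding sum_hist_prob[OF M] by (simp add: algebra_simps)
  also have "\<dots> = (\<Sum>h | length h = j * N. hist_prob M ?P h * (?G h - ?\<delta>))"
    by (simp add: sum_subtractf sum_distrib_right right_diff_distrib)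
  also have "\<dots> \<le> (\<Sum>h1 | length h1 = j * N. hist_prob M ?P h1 *
      (\<Sum>h2 | length h2 = N. hist_prob M (\<lambda>t. ?P (h1 @ t)) h2 * of_bool (accurate M r (block_data nq N (Suc j) (h1 @ h2)))))"
  proof (intro sum_mono mult_left_mono hist_prob_nonneg[OF M])
    fix h1 :: "bool list" assume "h1 \<in> {h. length h = j * N}"
    then have len: "length h1 = j * N" by simp
    let ?s = "sale M (?x h1)"
    have s: "0 \<le> ?s" "?s \<le> 1" using sale_bounds[OF M] by auto
    have hp: "hist_prob M (\<lambda>t. ?P (h1 @ t)) h2 = bernoulli_weight ?s h2" if "length h2 = N" for h2
      using that len by (intro hist_prob_const[OF M]) (simp add: block_price_block)
    have acc: "accurate M r (block_data nq N (Suc j) (h1 @ h2)) \<longleftrightarrow>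
        accurate M r (block_data nq N j h1) \<and> \<bar>?s - freq h2\<bar> \<le> r" if "length h2 = N" for h2
      using that len by (auto simp: accurate_def block_data_append)
    show "?G h1 - ?\<delta> \<le> (\<Sum>h2 | length h2 = N. hist_prob M (\<lambda>t. ?P (h1 @ t)) h2 *
        of_bool (accurate M r (block_data nq N (Suc j) (h1 @ h2))))"
    proof (cases "accurate M r (block_data nq N j h1)")
      case True
      have "(\<Sum>h2 | length h2 = N. bernoulli_weight ?s h2) = 1"
        using sum_bernoulli_weight_exp[of ?s 0 N] by simp
      then have "1 - ?\<delta> \<le> (\<Sum>h2 | length h2 = N. bernoulli_weight ?s h2)
          - (\<Sum>h2 | length h2 = N. if \<bar>?s - freq h2\<bar> \<le> r then 0 else bernoulli_weight ?s h2)"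
        using bernoulli_tail[OF s r N] by simp
      also have "\<dots> = (\<Sum>h2 | length h2 = N. bernoulli_weight ?s h2 * of_bool (\<bar>?s - freq h2\<bar> \<le> r))"
        unfolding sum_subtractf[symmetric] by (intro sum.cong) auto
      also have "\<dots> = (\<Sum>h2 | length h2 = N. hist_prob M (\<lambda>t. ?P (h1 @ t)) h2 *
        of_bool (accurate M r (block_data nq N (Suc j) (h1 @ h2))))"
        using hp acc True by (intro sum.cong) auto
      finally show ?thesis using True by simp
    next
      case False
      have "0 \<le> (\<Sum>h2 | length h2 = N. hist_prob M (\<lambda>t. ?P (h1 @ t)) h2 *
        of_bool (accurate M r (block_data nq N (Suc j) (h1 @ h2))))"
        by (intro sum_nonneg mult_nonneg_nonneg hist_prob_nonneg[OF M]) auto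
      moreover have "?G h1 - ?\<delta> \<le> 0" using False by simp
      ultimately show ?thesis by (rule order_trans[rotated])
    qed
  qed
  also have "\<dots> = (\<Sum>h | length h = j * N + N. hist_prob M ?P h * of_bool (accurate M r (block_data nq N (Suc j) h)))"
    unfolding sum_lists_append hist_prob_append[OF M] sum_distrib_left by (simp add: mult.assoc)
  finally show ?case by (simp add: add.commute)
qed (simp add: hist_prob_Nil accurate_def)

section \<open>Adaptive refinement\<close>

text \<open>The tolerance \<open>e / 200\<close> places any two compatible distributions within
  \<open>e / 100\<close> of each other at queried prices, the error allowed in
  \<open>sale_close\<close>.\<close>

definition consistent :: "real \<Rightarrow> (real \<times> real) list \<Rightarrow> real measure \<Rightarrow> bool" where
  "consistent e D M \<longleftrightarrow> regular01 M \<and> accurate M (e / 200) D"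

definition cell :: "nat \<Rightarrow> nat \<Rightarrow> real set" where
  "cell l k = {real k / 2 ^ l .. (real k + 1) / 2 ^ l}"

text \<open>The left neighbour is included because the extended chord starts there; for
  \<open>k = 0\<close> it is a negative price, where the sale probability is 1.\<close>

definition stencil :: "nat \<Rightarrow> nat \<Rightarrow> real set" where
  "stencil l k = {(real k - 1) / 2 ^ l, real k / 2 ^ l, (real k + 1) / 2 ^ l}"

definition ready :: "(real \<times> real) list \<Rightarrow> nat \<Rightarrow> nat \<Rightarrow> bool" where
  "ready D l k \<longleftrightarrow> stencil l k \<subseteq> fst ` set D"

text \<open>A test on the data alone, however hard to decide: the model charges for queries, not for
  computation.\<close>

definition certified :: "real \<Rightarrow> (real \<times> real) list \<Rightarrow> nat \<Rightarrow> nat \<Rightarrow> bool" where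
  "certified e D l k \<longleftrightarrow> (\<forall>M M'. consistent e D M \<longrightarrow> consistent e D M' \<longrightarrow>
      (\<forall>v\<in>cell l k. \<bar>sale M v - sale M' v\<bar> \<le> e))"

definition eligible :: "real \<Rightarrow> nat \<Rightarrow> (real \<times> real) list \<Rightarrow> nat \<Rightarrow> nat \<Rightarrow> bool" where
  "eligible e L D l k \<longleftrightarrow> l \<le> L \<and> k < 2 ^ l \<and>
     (l = 0 \<or> ready D (l - 1) (k div 2) \<and> \<not> certified e D (l - 1) (k div 2))"

definition wanted :: "real \<Rightarrow> nat \<Rightarrow> (real \<times> real) list \<Rightarrow> real set" where
  "wanted e L D = (\<Union>(l, k)\<in>{(l, k). eligible e L D l k}. stencil l k) - fst ` set D"

text \<open>The number of queries is fixed in advance, so leftover blocks are spent on the price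
  0.\<close>

definition next_query :: "real \<Rightarrow> nat \<Rightarrow> (real \<times> real) list \<Rightarrow> real" where
  "next_query e L D = (if wanted e L D = {} then 0 else (SOME x. x \<in> wanted e L D))"

text \<open>Any compatible distribution serves, because certificates compare all pairs of
  them.\<close>

definition estimate :: "real \<Rightarrow> (real \<times> real) list \<Rightarrow> real \<Rightarrow> real" where
  "estimate e D = cdf (SOME M. consistent e D M)"

lemma consistent_close:
  assumes "consistent e D M" "consistent e D M'" "x \<in> fst ` set D"
  shows "\<bar>sale M x - sale M' x\<bar> \<le> e / 100"
proof -
  obtain g where "(x, g) \<in> set D" using assms(3) by force
  then have "\<bar>sale M x - g\<bar> \<le> e / 200" "\<bar>sale M' x - g\<bar> \<le> e / 200"
    using assms(1,2) by (auto simp: consistent_def accurate_def)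
  then show ?thesis by linarith
qed

lemma consistent_subset: "consistent e D M \<Longrightarrow> set D' \<subseteq> set D \<Longrightarrow> consistent e D' M"
  by (auto simp: consistent_def accurate_def)

text \<open>Both competitors are compared with the flat \<open>M\<close>, whence
  \<open>e / 2 + e / 2\<close>. Read contrapositively, the algorithm refines only below curved cells
  of the true distribution.\<close>

lemma ready_flat_certified:
  assumes e: "0 < e" and M: "consistent e D M" and ready: "ready D l k"
    and flat: "\<not> curved M e (1 / 2 ^ l) (real k * (1 / 2 ^ l))"
  shows "certified e D l k"
proof -
  have *: "\<bar>sale M v - sale M' v\<bar> \<le> e / 2" if M': "consistent e D M'" and v: "v \<in> cell l k" for M' v
  proof (rule sale_close[OF _ _ e _ flat])
    show "regular01 M" "regular01 M'" using M M' by (auto simp: consistent_def)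
    show "real k * (1 / 2 ^ l) \<le> v" "v \<le> real k * (1 / 2 ^ l) + 1 / 2 ^ l"
      using v by (auto simp: cell_def add_divide_distrib)
    fix x assume "x \<in> {real k * (1 / 2 ^ l) - 1 / 2 ^ l, real k * (1 / 2 ^ l), real k * (1 / 2 ^ l) + 1 / 2 ^ l}"
    then have "x \<in> stencil l k" by (auto simp: stencil_def add_divide_distrib diff_divide_distrib)
    then show "\<bar>sale M x - sale M' x\<bar> \<le> e / 100"
      using ready by (intro consistent_close[OF M M']) (auto simp: ready_def)
  qed simp
  show ?thesis unfolding certified_def
  proof (intro allI impI ballI)
    fix M1 M2 v assume "consistent e D M1" "consistent e D M2" "v \<in> cell l k"
    from *[OF this(1,3)] *[OF this(2,3)] show "\<bar>sale M1 v - sale M2 v\<bar> \<le> e" by linarith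
  qed
qed

lemma eligible_curved:
  assumes "0 < e" "consistent e D M" "eligible e L D l k" "l \<noteq> 0"
  shows "curved M e (1 / 2 ^ (l - 1)) (real (k div 2) * (1 / 2 ^ (l - 1)))"
  using ready_flat_certified[OF assms(1,2)] assms(3,4) unfolding eligible_def by blast

lemma ready_of_not_wanted:
  assumes "wanted e L D = {}" "eligible e L D l k" shows "ready D l k"
  using assms by (auto simp: wanted_def ready_def)

text \<open>Descend with \<open>v\<close>: a ready cell without certificate makes its child
  containing \<open>v\<close> eligible, and as nothing is wanted that child is ready too.\<close>

lemma certified_or_ready:
  assumes nw: "wanted e L D = {}" and v: "0 \<le> v" "v \<le> 1"
  shows "l \<le> L \<Longrightarrow> (\<exists>l k. v \<in> cell l k \<and> certified e D l k) \<or> (\<exists>k<2^l. v \<in> cell l k \<and> ready D l k)"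
proof (induction l)
  case 0
  have "eligible e L D 0 0" by (simp add: eligible_def)
  from ready_of_not_wanted[OF nw this] v show ?case by (auto simp: cell_def intro!: exI[of _ 0])
next
  case (Suc l)
  show ?case
  proof (cases "\<exists>l k. v \<in> cell l k \<and> certified e D l k")
    case False
    then obtain k where k: "k < 2 ^ l" "v \<in> cell l k" "ready D l k" using Suc by auto
    have nc: "\<not> certified e D l k" using False k by blast
    obtain k' where k': "k' div 2 = k" "v \<in> cell (Suc l) k'" "k' < 2 ^ Suc l"
    proof (cases "v \<le> (2 * real k + 1) / 2 ^ Suc l")
      case True
      show ?thesis by (rule that[of "2 * k"]) (use k True in \<open>auto simp: cell_def field_simps\<close>)
    next
      case False
      show ?thesis by (rule that[of "2 * k + 1"]) (use k False in \<open>auto simp: cell_def field_simps\<close>)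
    qed
    have "eligible e L D (Suc l) k'" using Suc.prems k k' nc by (simp add: eligible_def)
    from ready_of_not_wanted[OF nw this] k' show ?thesis by blast
  qed simp
qed

lemma levy_of_not_wanted:
  assumes e: "0 < e" and nw: "wanted e L D = {}" and L: "1 / 2 ^ L \<le> e / 2"
    and M: "consistent e D M" "consistent e D M'"
  shows "levy (cdf M) (cdf M') \<le> ereal e"
proof -
  have *: "sale K' v \<le> sale K (v - e / 2) + e" if K: "consistent e D K" "consistent e D K'" for K K' v
  proof -
    have d: "dist01 K" "dist01 K'" using K by (auto simp: consistent_def intro: regular01_dist01)
    note b = sale_bounds[OF d(1)] sale_bounds[OF d(2)]
    consider "v < 0" | "1 < v" | "0 \<le> v" "v \<le> 1" by linarith
    then show ?thesis
    proof cases
      case 1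
      then show ?thesis using sale_nonpos[OF d(1), of "v - e / 2"] b(4)[of v] e by simp
    next
      case 2
      then show ?thesis using sale_gt_1[OF d(2)] b(1)[of "v - e / 2"] e by simp
    next
      case 3
      from certified_or_ready[OF nw 3 order_refl] show ?thesis
      proof (elim disjE exE conjE)
        fix l k assume "v \<in> cell l k" "certified e D l k"
        then have "\<bar>sale K v - sale K' v\<bar> \<le> e" using K by (auto simp: certified_def)
        moreover have "sale K v \<le> sale K (v - e / 2)" using e by (intro sale_antimono[OF d(1)]) simp
        ultimately show ?thesis by linarith
      next
        fix k assume k: "v \<in> cell L k" "ready D L k"
        \<comment> \<open>The horizontal slack is used here: the cell is at most
          \<open>e / 2\<close> wide, so its left endpoint, where an estimate exists, lies between
          \<open>v - e / 2\<close> and \<open>v\<close>.\<close>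
        let ?a = "real k / 2 ^ L"
        have a: "?a \<le> v" "v - e / 2 \<le> ?a" using k(1) L by (auto simp: cell_def add_divide_distrib)
        have "?a \<in> fst ` set D" using k(2) by (auto simp: ready_def stencil_def)
        then have "\<bar>sale K ?a - sale K' ?a\<bar> \<le> e / 100" by (rule consistent_close[OF K])
        moreover have "sale K' v \<le> sale K' ?a" "sale K ?a \<le> sale K (v - e / 2)"
          using a sale_antimono d by auto
        ultimately show ?thesis using e by linarith
      qed
    qed
  qed
  show ?thesis
    using M by (intro levy_leI[OF _ _ e] *) (auto simp: consistent_def intro: regular01_dist01)
qed

text \<open>A bound on the cells that can ever become eligible, described by the true distribution
  instead of the data, so that it stays the same during the run.\<close>

definition query_cells :: "real measure \<Rightarrow> real \<Rightarrow> nat \<Rightarrow> (nat \<times> nat) set" where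
  "query_cells M e L = insert (0, 0) (SIGMA l : {1..L}.
     {k. k < 2 ^ l \<and> curved M e (1 / 2 ^ (l - 1)) (real (k div 2) * (1 / 2 ^ (l - 1)))})"

text \<open>There are \<open>L\<close> levels, \<open>L\<close> dyadic classes on each, and two
  children per curved cell.\<close>

lemma card_query_cells:
  assumes "regular01 M" "0 < e" "1 / 2 ^ L \<le> e / 4"
  shows "real (card (query_cells M e L)) \<le> 1 + 2 * (real L)\<^sup>2 * (1 + 8 / sqrt e)" "finite (query_cells M e L)"
proof -
  let ?c = "\<lambda>l k. curved M e (1 / 2 ^ (l - 1)) (real k * (1 / 2 ^ (l - 1)))"
  define K where "K l = {k::nat. k < 2 ^ l \<and> ?c l (k div 2)}" for l
  have fin: "finite (K l)" for l by (auto simp: K_def)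
  have K: "real (card (K l)) \<le> 2 * (real L * (1 + 8 / sqrt e))" if "l \<in> {1..L}" for l
  proof -
    define X where "X = {k::nat. k < 2 ^ (l - 1) \<and> ?c l k}"
    have l: "(2::nat) ^ l = 2 * 2 ^ (l - 1)" using that by (cases l) auto
    have "K l \<subseteq> (\<lambda>i. 2 * i) ` X \<union> (\<lambda>i. 2 * i + 1) ` X"
    proof
      fix k assume k: "k \<in> K l"
      then have "k div 2 \<in> X" unfolding K_def X_def l by auto
      moreover have "k = 2 * (k div 2) \<or> k = 2 * (k div 2) + 1" by presburger
      ultimately show "k \<in> (\<lambda>i. 2 * i) ` X \<union> (\<lambda>i. 2 * i + 1) ` X" by blast
    qed
    moreover have fX: "finite X" by (simp add: X_def)
    ultimately have "card (K l) \<le> card ((\<lambda>i. 2 * i) ` X \<union> (\<lambda>i. 2 * i + 1) ` X)"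
      by (intro card_mono) auto
    also have "\<dots> \<le> card X + card X"
      using fX by (intro order_trans[OF card_Un_le] add_mono card_image_le)
    finally have "real (card (K l)) \<le> 2 * real (card X)" by simp
    also have "real (card X) \<le> real L * (1 + 8 / sqrt e)"
      unfolding X_def using assms by (intro card_curved) auto
    finally show ?thesis by simp
  qed
  have q: "query_cells M e L = insert (0, 0) (SIGMA l : {1..L}. K l)"
    by (simp add: query_cells_def K_def)
  show "finite (query_cells M e L)" unfolding q using fin by auto
  have "card (query_cells M e L) \<le> Suc (card (SIGMA l : {1..L}. K l))"
    unfolding q by (rule card_insert_le_m1[THEN order_trans]) auto
  also have "card (SIGMA l : {1..L}. K l) = (\<Sum>l\<in>{1..L}. card (K l))"
    using fin by (intro card_SigmaI) auto
  finally have "real (card (query_cells M e L)) \<le> 1 + (\<Sum>l\<in>{1..L}. real (card (K l)))"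
    by (metis of_nat_Suc of_nat_mono of_nat_sum add.commute)
  also have "\<dots> \<le> 1 + (\<Sum>l\<in>{1..L}. 2 * (real L * (1 + 8 / sqrt e)))"
    by (intro add_left_mono sum_mono K)
  finally show "real (card (query_cells M e L)) \<le> 1 + 2 * (real L)\<^sup>2 * (1 + 8 / sqrt e)"
    by (simp add: power2_eq_square mult_ac)
qed

lemma card_stencil_union:
  assumes "finite I" shows "card (\<Union>(l, k)\<in>I. stencil l k) \<le> 3 * card I"
proof -
  have "card (\<Union>(l, k)\<in>I. stencil l k) \<le> (\<Sum>(l, k)\<in>I. card (stencil l k))"
    using card_UN_le[OF assms, of "\<lambda>(l, k). stencil l k"] by (simp add: case_prod_beta)
  also have "\<dots> \<le> (\<Sum>_\<in>I. 3)"
    by (intro sum_mono) (auto simp: stencil_def card_insert_if)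
  finally show ?thesis by simp
qed

lemma set_block_data_mono: "i \<le> j \<Longrightarrow> set (block_data nq N i h) \<subseteq> set (block_data nq N j h)"
  by (induction j) (auto simp: le_Suc_eq)

text \<open>Every query made while something is still wanted hits a new point of a fixed small set
  depending only on the true distribution, so after more queries than that set has points nothing is wanted.\<close>
lemma levy_estimate:
  assumes e: "0 < e" and L: "1 / 2 ^ L \<le> e / 4"
    and m: "3 * (1 + 2 * (real L)\<^sup>2 * (1 + 8 / sqrt e)) < real m"
    and M: "consistent e (block_data (next_query e L) N m h) M"
  shows "levy (cdf M) (estimate e (block_data (next_query e L) N m h)) \<le> ereal e"
proof -
  let ?D = "\<lambda>j. block_data (next_query e L) N j h"
  let ?U = "\<Union>(l, k)\<in>query_cells M e L. stencil l k"
  have reg: "regular01 M" using M by (simp add: consistent_def)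
  note cells = card_query_cells[OF reg e L]
  have finU: "finite ?U" using cells(2) by (auto simp: stencil_def)
  have Mj: "consistent e (?D j) M" if "j \<le> m" for j
    using consistent_subset[OF M] set_block_data_mono[OF that] by blast
  have wU: "wanted e L (?D j) \<subseteq> ?U" if "j \<le> m" for j
  proof -
    have "(l, k) \<in> query_cells M e L" if "eligible e L (?D j) l k" for l k
      using eligible_curved[OF e Mj[OF \<open>j \<le> m\<close>] that] that
      by (cases "l = 0") (auto simp: query_cells_def eligible_def)
    then show ?thesis unfolding wanted_def by blast
  qed
  have "fst ` set (?D j) \<subseteq> ?U \<and> card (fst ` set (?D j)) = j"
    if "j \<le> m" "\<And>i. i < j \<Longrightarrow> wanted e L (?D i) \<noteq> {}" for j
    using that
  proof (induction j)
    case (Suc j)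
    let ?x = "next_query e L (?D j)"
    have "wanted e L (?D j) \<noteq> {}" using Suc.prems(2) by blast
    then have x: "?x \<in> wanted e L (?D j)" by (simp add: next_query_def some_in_eq)
    then have "?x \<in> ?U" using wU[of j] Suc.prems(1) by (meson Suc_leD subsetD)
    moreover have "?x \<notin> fst ` set (?D j)" using x by (simp add: wanted_def)
    ultimately show ?case using Suc by auto
  qed simp
  then have *: "card (fst ` set (?D m)) = m \<and> fst ` set (?D m) \<subseteq> ?U" if "\<And>i. i < m \<Longrightarrow> wanted e L (?D i) \<noteq> {}"
    using that by blast
  have "\<exists>j<m. wanted e L (?D j) = {}"
  proof (rule ccontr)
    assume "\<not> (\<exists>j<m. wanted e L (?D j) = {})"
    with * have "m \<le> card ?U" using card_mono[OF finU] by metis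
    also have "\<dots> \<le> 3 * card (query_cells M e L)" by (rule card_stencil_union[OF cells(2)])
    finally have "real m \<le> 3 * real (card (query_cells M e L))" by linarith
    also have "\<dots> \<le> 3 * (1 + 2 * (real L)\<^sup>2 * (1 + 8 / sqrt e))"
      using cells(1) by (intro mult_left_mono) auto
    finally show False using m by simp
  qed
  \<comment> \<open>The run goes on after stage \<open>j\<close>, but more data only shrink the set
    of compatible distributions, so the truth and the final estimate are both compatible with stage
    \<open>j\<close>.\<close>
  then obtain j where j: "j < m" "wanted e L (?D j) = {}" by blast
  let ?M' = "SOME M. consistent e (?D m) M"
  have "consistent e (?D m) ?M'" using M by (rule someI)
  then have "consistent e (?D j) ?M'" using consistent_subset set_block_data_mono j(1) less_imp_le by metis
  then show ?thesis
    unfolding estimate_def using e j L Mj[of j] by (intro levy_of_not_wanted[OF e j(2)]) auto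
qed

lemma prob_levy_estimate:
  assumes e: "0 < e" "e \<le> 1" and L: "1 / 2 ^ L \<le> e / 4"
    and m: "3 * (1 + 2 * (real L)\<^sup>2 * (1 + 8 / sqrt e)) < real m"
    and N: "0 < N" and M: "regular01 M"
  shows "1 - real m * (2 * exp (- real N * (e / 200)\<^sup>2 / 4))
    \<le> det_success M (block_price (next_query e L) N, \<lambda>h. estimate e (block_data (next_query e L) N m h)) (m * N) e"
proof -
  let ?P = "block_price (next_query e L) N" and ?D = "block_data (next_query e L) N m"
  have d: "dist01 M" using M by (rule regular01_dist01)
  have "1 - real m * (2 * exp (- real N * (e / 200)\<^sup>2 / 4))
      \<le> (\<Sum>h | length h = m * N. hist_prob M ?P h * of_bool (accurate M (e / 200) (?D h)))"
    using e N by (intro prob_accurate[OF d]) auto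
  also have "\<dots> \<le> (\<Sum>h | length h = m * N. hist_prob M ?P h * (if levy (cdf M) (estimate e (?D h)) \<le> ereal e then 1 else 0))"
  proof (intro sum_mono mult_left_mono hist_prob_nonneg[OF d])
    fix h
    have "levy (cdf M) (estimate e (?D h)) \<le> ereal e" if "accurate M (e / 200) (?D h)"
      using that M by (intro levy_estimate[OF e(1) L m]) (simp add: consistent_def)
    then show "of_bool (accurate M (e / 200) (?D h)) \<le> (if levy (cdf M) (estimate e (?D h)) \<le> ereal e then 1 else (0::real))"
      by auto
  qed
  finally show ?thesis by (simp add: det_success_def)
qed

section \<open>Parameters of the upper bound\<close>

lemma rand_success_return:
  "rand_success (return (count_space UNIV) A) M n e = ennreal (det_success M A n e)"
  unfolding rand_success_def by (simp add: nn_integral_return)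

text \<open>Two logarithms come from the levels and the dyadic classes in \<open>m\<close>, the
  third from the union bound in \<open>N\<close>; \<open>(ln 2) ^ 3\<close> turns binary logarithms
  into natural ones.\<close>

lemma pricing_upper_bound:
  "\<exists>C>0. \<exists>k::nat. \<forall>\<epsilon>\<in>{0<..1/2}. \<exists>(n::nat) (Q::pricing_alg measure).
            prob_space Q \<and>
            real n \<le> C * \<epsilon> powr (-5/2) * (ln (1/\<epsilon>)) ^ k \<and>
            (\<forall>M. regular01 M \<longrightarrow> rand_success Q M n \<epsilon> \<ge> ennreal (1 - \<epsilon>))"
proof (intro exI conjI ballI)
  \<comment> \<open>\<open>868 = 3 * 2 * 16 * 9 + 4\<close> comes from the bound on
    \<open>m\<close>, \<open>2720001 = 160000 * 17 + 1\<close> from the bound on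
    \<open>N\<close>.\<close>
  let ?C = "868 * 2720001 / (ln 2) ^ 3 :: real"
  show "0 < ?C" by simp
  fix e :: real assume "e \<in> {0<..1/2}"
  then have e: "0 < e" "e \<le> 1 / 2" by auto
  define \<mu> where "\<mu> = log 2 (1 / e)"
  have \<mu>ln: "ln (1 / e) = \<mu> * ln 2" by (simp add: \<mu>_def log_def)
  have \<mu>: "1 \<le> \<mu>" unfolding \<mu>_def using e by (subst le_log_iff) (auto simp: field_simps)
  define X where "X = 1 / sqrt e"
  have sq: "sqrt e \<le> 1" using e by (simp add: real_sqrt_le_1_iff)
  have X: "1 \<le> X" "X \<le> 1 / e"
  proof -
    show "1 \<le> X" using sq e by (simp add: X_def)
    have "sqrt e * sqrt e \<le> 1 * sqrt e" using sq e by (intro mult_right_mono) auto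
    then have "e \<le> sqrt e" using e by simp
    then show "X \<le> 1 / e" unfolding X_def using e by (intro divide_left_mono) auto
  qed
  have X5: "e powr (-5/2) = X * (1 / e ^ 2)"
  proof -
    have "e powr (-5/2) = e powr (-1/2) * e powr (-2)" using powr_add[of e "-1/2" "-2"] by simp
    also have "e powr (-1/2) = X" using powr_minus_divide[of e "1/2"] powr_half_sqrt[of e] e by (simp add: X_def)
    also have "e powr (-2) = 1 / e ^ 2" using powr_minus_divide[of e 2] e by simp
    finally show ?thesis .
  qed
  define L where "L = nat \<lceil>log 2 (4 / e)\<rceil>"
  have log4: "log 2 (4 / e) = 2 + \<mu>"
  proof -
    have "log 2 (4::real) = 2" using log_pow_cancel[of 2 2] by simp
    then show ?thesis unfolding \<mu>_def using log_mult[of 2 4 "1 / e"] e by simp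
  qed
  have Lle: "real L \<le> 4 * \<mu>" and Lge: "log 2 (4 / e) \<le> real L"
    unfolding L_def log4 using \<mu> by linarith+
  have "4 / e \<le> 2 ^ L" using Lge e by (simp add: log_le_iff powr_realpow)
  then have L: "1 / 2 ^ L \<le> e / 4" using e by (simp add: field_simps)
  define m where "m = nat \<lfloor>3 * (1 + 2 * (real L)\<^sup>2 * (1 + 8 / sqrt e))\<rfloor> + 1"
  have mgt: "3 * (1 + 2 * (real L)\<^sup>2 * (1 + 8 / sqrt e)) < real m"
    unfolding m_def by linarith
  have mle: "real m \<le> 868 * \<mu>\<^sup>2 * X"
  proof -
    have "real m \<le> 3 * (1 + 2 * (real L)\<^sup>2 * (1 + 8 / sqrt e)) + 1"
    proof -
      have "0 \<le> 3 * (1 + 2 * (real L)\<^sup>2 * (1 + 8 / sqrt e))" using e by simp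
      then show ?thesis unfolding m_def by linarith
    qed
    also have "\<dots> \<le> 3 * (1 + 2 * (4 * \<mu>)\<^sup>2 * (X + 8 * X)) + 1"
      using Lle X \<mu> by (intro add_mono mult_left_mono mult_mono power_mono) (auto simp: X_def)
    also have "\<dots> = 4 + 864 * \<mu>\<^sup>2 * X" by (simp add: power2_eq_square)
    also have "\<dots> \<le> 4 * (\<mu>\<^sup>2 * X) + 864 * \<mu>\<^sup>2 * X"
    proof -
      have "1 * 1 \<le> \<mu>\<^sup>2 * X" using \<mu> X by (intro mult_mono) auto
      then show ?thesis by (simp add: mult.commute)
    qed
    finally show ?thesis by (simp add: mult_ac)
  qed
  have m1: "1 \<le> real m" by (simp add: m_def)
  \<comment> \<open>This makes \<open>N * (e / 200)^2 / 4\<close> at least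
    \<open>ln (2 * m / e)\<close>, so that some block fails with probability at most
    \<open>e\<close>.\<close>
  define N where "N = nat \<lceil>160000 / e\<^sup>2 * ln (2 * real m / e)\<rceil>"
  have ratio: "2 * real m / e \<ge> 4" using m1 e by (simp add: field_simps)
  then have lnpos: "0 < ln (2 * real m / e)" by (intro ln_gt_zero) simp
  have Nge: "160000 / e\<^sup>2 * ln (2 * real m / e) \<le> real N"
    unfolding N_def by linarith
  then have N0: "0 < N" proof -
    have "0 < 160000 / e\<^sup>2 * ln (2 * real m / e)" using lnpos e by simp
    with Nge have "0 < real N" by linarith
    then show ?thesis by simp
  qed
  \<comment> \<open>\<open>17 = 13 + 4\<close>, since
    \<open>2 * m / e <= 6944 / e^4 <= 2 ^ 13 / e^4\<close>.\<close>
  have lnle: "ln (2 * real m / e) \<le> 17 * \<mu>"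
  proof -
    have "\<mu> \<le> 2 / e"
    proof -
      have "\<mu> * ln 2 \<le> 1 / e - 1" unfolding \<mu>ln[symmetric] using e by (intro ln_le_minus_one) simp
      moreover have "\<mu> * (1 / 2) \<le> \<mu> * ln 2" using ln2_ge_two_thirds \<mu> by (intro mult_left_mono) auto
      ultimately have "\<mu> * (1 / 2) \<le> 1 / e" by linarith
      then show ?thesis by (simp add: mult.commute)
    qed
    then have "real m \<le> 868 * (2 / e)\<^sup>2 * (1 / e)"
      using mle X \<mu> e by (elim order_trans) (intro mult_mono power_mono, auto)
    then have "2 * real m / e \<le> 2 * (868 * (2 / e)\<^sup>2 * (1 / e)) / e"
      using e by (intro divide_right_mono mult_left_mono) auto
    also have "\<dots> = 6944 * (1 / e) ^ 4" using e by (simp add: power2_eq_square power4_eq_xxxx)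
    also have "\<dots> \<le> 2 ^ 13 * (1 / e) ^ 4" using e by (intro mult_right_mono) auto
    finally have "ln (2 * real m / e) \<le> ln (2 ^ 13 * (1 / e) ^ 4)"
      using ratio by (intro ln_mono) auto
    also have "\<dots> = ln (2 ^ 13) + ln ((1 / e) ^ 4)" using e by (intro ln_mult_pos) auto
    also have "\<dots> = 13 * ln 2 + 4 * ln (1 / e)" using e by (subst (1 2) ln_realpow) auto
    also have "\<dots> \<le> ln 2 * (17 * \<mu>)"
    proof -
      have "13 * ln 2 * 1 \<le> 13 * ln 2 * \<mu>" using \<mu> by (intro mult_left_mono) auto
      then show ?thesis unfolding \<mu>ln by simp
    qed
    also have "\<dots> \<le> 1 * (17 * \<mu>)" using \<mu> ln_2_less_1 by (intro mult_right_mono) auto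
    finally show ?thesis by simp
  qed
  have Nle: "real N \<le> 2720001 * \<mu> * (1 / e\<^sup>2)"
  proof -
    have "0 \<le> 160000 / e\<^sup>2 * ln (2 * real m / e)" using lnpos by simp
    then have "real N \<le> 160000 / e\<^sup>2 * ln (2 * real m / e) + 1" unfolding N_def by linarith
    also have "\<dots> \<le> 160000 / e\<^sup>2 * (17 * \<mu>) + \<mu> * (1 / e\<^sup>2)"
    proof (intro add_mono mult_left_mono lnle)
      have "1 * 1 \<le> \<mu> * (1 / e\<^sup>2)" using \<mu> e by (intro mult_mono) (auto simp: field_simps power_le_one)
      then show "1 \<le> \<mu> * (1 / e\<^sup>2)" by simp
    qed simp
    finally show ?thesis by simp
  qed
  let ?A = "(block_price (next_query e L) N, \<lambda>h. estimate e (block_data (next_query e L) N m h)) :: pricing_alg"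
  let ?Q = "return (count_space UNIV) ?A"
  show "prob_space ?Q" by (intro prob_space_return) simp
  have "real (m * N) \<le> (868 * \<mu>\<^sup>2 * X) * (2720001 * \<mu> * (1 / e\<^sup>2))"
    unfolding of_nat_mult using mle Nle by (rule mult_mono) (use \<mu> X in auto)
  also have "\<dots> = ?C * e powr (-5/2) * ln (1 / e) ^ 3"
    unfolding X5 \<mu>ln by (simp add: power_mult_distrib power2_eq_square power3_eq_cube)
  finally show "real (m * N) \<le> ?C * e powr (-5/2) * ln (1 / e) ^ 3" .
  show "\<forall>M. regular01 M \<longrightarrow> ennreal (1 - e) \<le> rand_success ?Q M (m * N) e"
  proof (intro allI impI)
    fix M assume M: "regular01 M"
    have "ln (2 * real m / e) \<le> real N * (e / 200)\<^sup>2 / 4"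
      using Nge e by (simp add: field_simps power2_eq_square)
    then have "exp (ln (2 * real m / e)) \<le> exp (real N * (e / 200)\<^sup>2 / 4)" by simp
    then have "2 * real m / e \<le> exp (real N * (e / 200)\<^sup>2 / 4)" using ratio by simp
    then have "2 * real m \<le> e * exp (real N * (e / 200)\<^sup>2 / 4)"
      using e by (simp add: pos_divide_le_eq mult.commute)
    then have "real m * 2 / exp (real N * (e / 200)\<^sup>2 / 4) \<le> e"
      by (simp add: pos_divide_le_eq)
    moreover have "exp (- real N * (e / 200)\<^sup>2 / 4) = 1 / exp (real N * (e / 200)\<^sup>2 / 4)"
    proof -
      have "- real N * (e / 200)\<^sup>2 / 4 = - (real N * (e / 200)\<^sup>2 / 4)" by simp
      then show ?thesis by (simp only: exp_minus inverse_eq_divide)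
    qed
    ultimately have "real m * (2 * exp (- real N * (e / 200)\<^sup>2 / 4)) \<le> e"
      by simp
    then have "1 - e \<le> det_success M ?A (m * N) e"
      using prob_levy_estimate[OF e(1) _ L mgt N0 M] e by linarith
    then show "ennreal (1 - e) \<le> rand_success ?Q M (m * N) e"
      unfolding rand_success_return by (rule ennreal_leI)
  qed
qed

section \<open>Regular distributions from convex functions\<close>

text \<open>The remaining mass \<open>1 / h 1\<close> becomes an atom at 1, so \<open>1 / h\<close>
  need not vanish there.\<close>

definition truncated_cdf :: "(real \<Rightarrow> real) \<Rightarrow> real \<Rightarrow> real" where
  "truncated_cdf h v = (if v < 0 then 0 else if v < 1 then 1 - 1 / h v else 1)"

locale reciprocal_sale =
  fixes h :: "real \<Rightarrow> real"
  assumes isCont_h: "\<And>v. isCont h v"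
    and convex_h: "convex_on {0..1} h"
    and strict_h: "\<And>x y. 0 \<le> x \<Longrightarrow> x < y \<Longrightarrow> y \<le> 1 \<Longrightarrow> h x < h y"
    and h_0: "h 0 = 1"
begin

definition market :: "real measure" where
  "market = interval_measure (truncated_cdf h)"

lemma mono_h: "0 \<le> x \<Longrightarrow> x \<le> y \<Longrightarrow> y \<le> 1 \<Longrightarrow> h x \<le> h y"
  using strict_h[of x y] by (cases "x = y") auto

lemma h_ge_1: "0 \<le> x \<Longrightarrow> x \<le> 1 \<Longrightarrow> 1 \<le> h x"
  using mono_h[of 0 x] h_0 by simp

lemma truncated_cdf_mono:
  assumes "x \<le> y" shows "truncated_cdf h x \<le> truncated_cdf h y"
proof -
  have "1 - 1 / h x \<le> 1 - 1 / h y" if "0 \<le> x" "y < 1"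
    using that assms mono_h[of x y] h_ge_1[of x] by (simp add: frac_le)
  moreover have "0 \<le> 1 - 1 / h v" "1 - 1 / h v \<le> 1" if "0 \<le> v" "v < 1" for v
    using that h_ge_1[of v] by auto
  ultimately show ?thesis using assms by (auto simp: truncated_cdf_def)
qed

lemma truncated_cdf_tendsto:
  assumes "0 \<le> a" "a \<le> 1" shows "((\<lambda>v. 1 - 1 / h v) \<longlongrightarrow> 1 - 1 / h a) (at a within S)"
proof -
  have "(h \<longlongrightarrow> h a) (at a within S)" using isCont_h[of a] unfolding isCont_def by (rule tendsto_within_subset) simp
  then show ?thesis using h_ge_1[OF assms] by (intro tendsto_intros) auto
qed

lemma truncated_cdf_right_cont: "continuous (at_right a) (truncated_cdf h)"
proof -
  consider "a < 0" | "0 \<le> a" "a < 1" | "1 \<le> a" by linarith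
  then show ?thesis unfolding continuous_within
  proof cases
    case 1
    then have "eventually (\<lambda>v. truncated_cdf h a = truncated_cdf h v) (at_right a)"
      by (auto simp: eventually_at_right_field truncated_cdf_def intro!: exI[of _ 0])
    then show "(truncated_cdf h \<longlongrightarrow> truncated_cdf h a) (at_right a)"
      by (rule Lim_transform_eventually[OF tendsto_const])
  next
    case 2
    then have ev: "eventually (\<lambda>v. 1 - 1 / h v = truncated_cdf h v) (at_right a)"
      by (auto simp: eventually_at_right_field truncated_cdf_def intro!: exI[of _ 1])
    have "truncated_cdf h a = 1 - 1 / h a" using 2 by (simp add: truncated_cdf_def)
    moreover have "((\<lambda>v. 1 - 1 / h v) \<longlongrightarrow> 1 - 1 / h a) (at_right a)"
      using 2 by (intro truncated_cdf_tendsto) auto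
    ultimately show "(truncated_cdf h \<longlongrightarrow> truncated_cdf h a) (at_right a)"
      using Lim_transform_eventually[OF _ ev] by simp
  next
    case 3
    then have "eventually (\<lambda>v. truncated_cdf h a = truncated_cdf h v) (at_right a)"
      by (auto simp: eventually_at_right_field truncated_cdf_def intro!: exI[of _ "a + 1"])
    then show "(truncated_cdf h \<longlongrightarrow> truncated_cdf h a) (at_right a)"
      by (rule Lim_transform_eventually[OF tendsto_const])
  qed
qed

lemma truncated_cdf_at_bot: "(truncated_cdf h \<longlongrightarrow> 0) at_bot"
proof -
  have "eventually (\<lambda>v. 0 = truncated_cdf h v) at_bot"
    by (auto simp: eventually_at_bot_dense truncated_cdf_def intro!: exI[of _ 0])
  then show ?thesis by (rule Lim_transform_eventually[OF tendsto_const])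
qed

lemma truncated_cdf_at_top: "(truncated_cdf h \<longlongrightarrow> 1) at_top"
proof -
  have "eventually (\<lambda>v. 1 = truncated_cdf h v) at_top"
    by (auto simp: eventually_at_top_dense truncated_cdf_def intro!: exI[of _ 1])
  then show ?thesis by (rule Lim_transform_eventually[OF tendsto_const])
qed

lemma real_distribution_market: "real_distribution market"
  unfolding market_def
  by (intro real_distribution_interval_measure truncated_cdf_mono truncated_cdf_right_cont
        truncated_cdf_at_bot truncated_cdf_at_top)

lemma cdf_market: "cdf market = truncated_cdf h"
  unfolding market_def
  by (intro cdf_interval_measure truncated_cdf_mono truncated_cdf_right_cont truncated_cdf_at_bot)

lemma dist01_market: "dist01 market"
proof -
  interpret real_distribution market by (rule real_distribution_market)
  have "measure market {0<..1} = truncated_cdf h 1 - truncated_cdf h 0"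
    unfolding market_def
    by (intro measure_interval_measure_Ioc truncated_cdf_mono truncated_cdf_right_cont) auto
  then have "measure market {0<..1} = 1" by (simp add: h_0 truncated_cdf_def)
  moreover have "measure market {0<..1} \<le> measure market {0..1}" by (intro finite_measure_mono) auto
  ultimately have "measure market {0..1} = 1" using prob_le_1[of "{0..1}"] by simp
  then show ?thesis unfolding dist01_def by (simp add: prob_space_axioms)
qed

lemma sale_market:
  assumes "0 \<le> p" "p \<le> 1" shows "sale market p = 1 / h p"
proof (cases "p = 0")
  case True
  then show ?thesis using sale_nonpos[OF dist01_market, of 0] h_0 by simp
next
  case False
  interpret real_distribution market by (rule real_distribution_market)
  have "eventually (\<lambda>v. 1 - 1 / h v = cdf market v) (at_left p)"
    using False assms by (auto simp: eventually_at_left_field cdf_market truncated_cdf_def intro!: exI[of _ 0])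
  from Lim_transform_eventually[OF truncated_cdf_tendsto[OF assms] this]
  have "measure market {..<p} = 1 - 1 / h p"
    using cdf_at_left by (intro tendsto_unique[OF _ cdf_at_left]) auto
  then show ?thesis using sale_compl[OF dist01_market, of p] by simp
qed

text \<open>An inverse of \<open>h\<close> would fail for \<open>q\<close> below the atom, where the
  quantile is stuck at 1; the description as the largest admissible price covers all positive
  \<open>q\<close>.\<close>

lemma quantile01_market:
  assumes q: "0 < q" "q \<le> 1"
  defines "v \<equiv> quantile01 (cdf market) (1 - q)"
  shows "0 \<le> v" "v \<le> 1" "h v \<le> 1 / q" "\<And>y. 0 \<le> y \<Longrightarrow> y \<le> 1 \<Longrightarrow> h y \<le> 1 / q \<Longrightarrow> y \<le> v"
proof -
  let ?S = "{x \<in> {0..1}. 1 - q \<le> cdf market x}"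
  have v: "v = Inf ?S" by (simp add: v_def quantile01_def)
  have 1: "1 \<in> ?S" using q by (simp add: cdf_market truncated_cdf_def)
  have bdd: "bdd_below ?S" by (auto intro!: bdd_belowI[of _ 0])
  show "0 \<le> v" unfolding v using 1 by (intro cInf_greatest) auto
  show "v \<le> 1" unfolding v using 1 bdd by (rule cInf_lower)
  show "y \<le> v" if y: "0 \<le> y" "y \<le> 1" "h y \<le> 1 / q" for y
    unfolding v
  proof (rule cInf_greatest)
    fix x assume x: "x \<in> ?S"
    show "y \<le> x"
    proof (rule ccontr)
      assume "\<not> y \<le> x"
      then have xy: "x < y" by simp
      then have "h x < 1 / q" using strict_h[of x y] x y by auto
      moreover have "1 / h x \<le> q" using x xy y by (auto simp: cdf_market truncated_cdf_def)
      moreover have "1 \<le> h x" using x by (auto intro: h_ge_1)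
      ultimately show False using q by (simp add: field_simps)
    qed
  qed (use 1 in blast)
  show "h v \<le> 1 / q"
  proof (rule ccontr)
    assume "\<not> h v \<le> 1 / q"
    then have hv: "1 / q < h v" by simp
    have "1 \<le> 1 / q" using q by simp
    then have "v \<noteq> 0" using hv h_0 by auto
    then have v0: "0 < v" using \<open>0 \<le> v\<close> by simp
    have "(h \<longlongrightarrow> h v) (at_left v)" using isCont_h[of v] unfolding isCont_def by (rule tendsto_within_subset) simp
    then have "eventually (\<lambda>x. 1 / q < h x) (at_left v)" using hv by (rule order_tendstoD)
    moreover have "eventually (\<lambda>x. 0 < x) (at_left v)" "eventually (\<lambda>x. x < v) (at_left v)"
      using v0 by (auto simp: eventually_at_left_field)
    ultimately have "eventually (\<lambda>x. 1 / q < h x \<and> 0 < x \<and> x < v) (at_left v)" by eventually_elim simp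
    then obtain x where x: "1 / q < h x" "0 < x" "x < v"
      using eventually_happens'[OF trivial_limit_at_left_real] by blast
    have "0 < h x" using h_ge_1[of x] x \<open>v \<le> 1\<close> by simp
    moreover have "1 < q * h x" using x(1) q by (simp add: pos_divide_less_eq mult.commute)
    ultimately have "1 / h x \<le> q" by (simp add: pos_divide_le_eq)
    then have "x \<in> ?S" using x \<open>v \<le> 1\<close> by (simp add: cdf_market truncated_cdf_def)
    then have "v \<le> x" unfolding v using bdd by (rule cInf_lower)
    with x show False by simp
  qed
qed

text \<open>The revenue curve is the perspective of the inverse of the convex function \<open>h\<close>, hence concave.\<close>
lemma regular01_market: "regular01 market"
  unfolding regular01_def
proof (intro conjI dist01_market concave_on_linorderI)
  fix t x y :: real assume t: "0 < t" "t < 1" and xy: "x \<in> {0..1}" "y \<in> {0..1}" "x < y"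
  let ?R = "revenue_curve (cdf market)"
  define v where "v q = quantile01 (cdf market) (1 - q)" for q
  note Q = quantile01_market[folded v_def]
  have R: "?R q = q * v q" for q by (simp add: revenue_curve_def v_def)
  define q where "q = (1 - t) * x + t * y"
  have q: "0 < q" using t xy by (auto simp: q_def intro!: add_nonneg_pos)
  have "q \<le> (1 - t) * 1 + t * 1" unfolding q_def using t xy by (intro add_mono mult_left_mono) auto
  then have q1: "q \<le> 1" by simp
  \<comment> \<open>At quantile 0 the revenue is 0 whatever the quantile function returns; the price
    0 stands in for it.\<close>
  define vx where "vx = (if x = 0 then 0 else v x)"
  have x: "0 \<le> vx" "vx \<le> 1" "x * h vx \<le> 1" "?R x = x * vx"
    using Q(1-3)[of x] xy by (auto simp: vx_def R field_simps)
  have y: "0 \<le> v y" "v y \<le> 1" "y * h (v y) \<le> 1"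
    using Q(1-3)[of y] xy by (auto simp: field_simps)
  define a where "a = (1 - t) * x / q"
  define b where "b = t * y / q"
  have ab: "0 \<le> a" "0 \<le> b" "a + b = 1"
    using t xy q by (auto simp: a_def b_def q_def add_divide_distrib[symmetric])
  have "h (a *\<^sub>R vx + b *\<^sub>R v y) \<le> a * h vx + b * h (v y)"
    using convex_h x y ab unfolding convex_on_def by auto
  also have "\<dots> = ((1 - t) * (x * h vx) + t * (y * h (v y))) / q"
    by (simp add: a_def b_def add_divide_distrib)
  also have "\<dots> \<le> ((1 - t) * 1 + t * 1) / q"
    using t q x y by (intro divide_right_mono add_mono mult_left_mono) auto
  finally have "h (a * vx + b * v y) \<le> 1 / q" by simp
  moreover have "a * vx + b * v y \<le> a * 1 + b * 1" using ab x y by (intro add_mono mult_left_mono) auto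
  ultimately have "a * vx + b * v y \<le> v q" using ab x y by (intro Q(4) q q1) auto
  then have "q * (a * vx + b * v y) \<le> q * v q" using q by (intro mult_left_mono) auto
  also have "q * (a * vx + b * v y) = (1 - t) * ?R x + t * ?R y"
    unfolding x(4) R[of y] a_def b_def using q by (simp add: distrib_left)
  finally show "(1 - t) * ?R x + t * ?R y \<le> ?R ((1 - t) *\<^sub>R x + t *\<^sub>R y)"
    by (simp add: R[of q] flip: q_def)
qed simp

end

text \<open>The infimum need not be attained, hence the larger \<open>e'\<close>; monotonicity of
  \<open>F\<close> enlarges a witness to \<open>e'\<close>, while \<open>G\<close> stays arbitrary
  like the output of an algorithm.\<close>

lemma levy_leD:
  assumes "levy F G \<le> ereal e" "e < e'" "mono F"
  shows "F (v - e') - e' \<le> G v" "G v \<le> F (v + e') + e'"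
proof -
  have "levy F G < ereal e'" using assms by (metis ereal_less(2) less_ereal.simps(1) order_le_less_trans)
  then obtain d where d: "d < e'" "\<forall>v. F (v - d) - d \<le> G v \<and> G v \<le> F (v + d) + d"
    unfolding levy_def INF_less_iff by auto
  have "F (v - e') \<le> F (v - d)" "F (v + d) \<le> F (v + e')" using d(1) by (auto intro: monoD[OF assms(3)])
  moreover have "F (v - d) - d \<le> G v" "G v \<le> F (v + d) + d" using d(2) by auto
  ultimately show "F (v - e') - e' \<le> G v" "G v \<le> F (v + e') + e'" using d(1) by linarith+
qed

section \<open>Indistinguishability\<close>

definition binary_kl :: "real \<Rightarrow> real \<Rightarrow> real" where
  "binary_kl a b = a * ln (a / b) + (1 - a) * ln ((1 - a) / (1 - b))"

text \<open>\<open>ln z <= z - 1\<close> bounds the divergence by the chi-squared distance, which is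
  quadratic in \<open>a - b\<close>: the source of the factor \<open>e^-2\<close> in the lower
  bound.\<close>

lemma binary_kl_le:
  assumes a: "0 < a" "a < 1" and b: "0 < b" "b < 1"
  shows "binary_kl a b \<le> (a - b)\<^sup>2 / (b * (1 - b))"
proof -
  have "ln (a / b) \<le> a / b - 1" "ln ((1 - a) / (1 - b)) \<le> (1 - a) / (1 - b) - 1"
    using a b by (auto intro!: ln_le_minus_one)
  then have "binary_kl a b \<le> a * (a / b - 1) + (1 - a) * ((1 - a) / (1 - b) - 1)"
    unfolding binary_kl_def using a by (intro add_mono mult_left_mono) auto
  also have "\<dots> = (a - b)\<^sup>2 / (b * (1 - b))"
    using b by (simp add: field_simps power2_eq_square)
  finally show ?thesis .
qed

definition path_kl :: "real measure \<Rightarrow> real measure \<Rightarrow> (bool list \<Rightarrow> real) \<Rightarrow> nat \<Rightarrow> real" where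
  "path_kl M K P n = (\<Sum>h | length h = n. hist_prob M P h * ln (hist_prob M P h / hist_prob K P h))"

definition expected_visits :: "real measure \<Rightarrow> (bool list \<Rightarrow> real) \<Rightarrow> nat \<Rightarrow> real set \<Rightarrow> real" where
  "expected_visits M P n I = (\<Sum>t<n. \<Sum>h | length h = t. hist_prob M P h * of_bool (P h \<in> I))"

text \<open>A form of Pinsker's inequality that stays linear in the divergence: \<open>\<bar>x - y\<bar>\<close> factors through
  the square roots, AM-GM separates the factors, and \<open>ln z \<le> z - 1\<close> at \<open>z = sqrt (y / x)\<close>
  bounds the squared Hellinger term.\<close>
lemma disjoint_events_le:
  fixes x y c d :: real
  assumes xy: "0 < x" "0 < y" and cd: "0 \<le> c" "0 \<le> d" "c + d \<le> 1"
  shows "x * c + y * d \<le> 7 / 12 * (x + y) + 3 / 2 * (x * ln (x / y) + y - x)"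
proof -
  define a where "a = sqrt x"
  define b where "b = sqrt y"
  have ab: "0 < a" "0 < b" "x = a * a" "y = b * b" using xy by (auto simp: a_def b_def)
  have "ln (b / a) \<le> b / a - 1" using ab by (intro ln_le_minus_one) auto
  then have "(2 * x) * (1 - b / a) \<le> (2 * x) * (- ln (b / a))" using xy by (intro mult_left_mono) auto
  also have "\<dots> = x * ln (x / y)" using ab by (simp add: ln_div ln_mult algebra_simps)
  finally have 1: "2 * x - 2 * (a * b) \<le> x * ln (x / y)" using ab by (simp add: algebra_simps)
  have "x * c + y * d \<le> max x y * c + max x y * d" using cd by (intro add_mono mult_right_mono) auto
  also have "\<dots> \<le> max x y * 1" unfolding distrib_left[symmetric] using cd xy by (intro mult_left_mono) auto
  finally have 2: "x * c + y * d \<le> max x y" by simp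
  \<comment> \<open>\<open>max x y\<close> is \<open>(x + y) / 2\<close> plus
    \<open>(a + b) * abs (a - b) / 2\<close>. The weight 6 keeps the final coefficient
    \<open>7 / 12 = 1 / 2 + 2 / 24\<close> below the required success probability
    \<open>2 / 3\<close>.\<close>
  have "0 \<le> ((a + b) / 6 - (a - b))\<^sup>2" "0 \<le> ((a + b) / 6 + (a - b))\<^sup>2" by auto
  then have "max x y \<le> (x + y) / 2 + ((a + b) * (a + b) / 24 + 3 / 2 * ((a - b) * (a - b)))"
    unfolding ab by (auto simp: max_def power2_eq_square field_simps)
  moreover have "(a + b) * (a + b) \<le> 2 * (x + y)"
    using zero_le_square[of "a - b"] unfolding ab by (simp add: algebra_simps)
  moreover have "(a - b) * (a - b) = x + y - 2 * (a * b)" unfolding ab by (simp add: algebra_simps)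
  moreover have "m \<le> 7 / 12 * s + 3 / 2 * r"
    if "m \<le> s / 2 + (p / 24 + 3 / 2 * q)" "p \<le> 2 * s" "q = r" for m s p q r :: real
    using that by linarith
  ultimately have "max x y \<le> 7 / 12 * (x + y) + 3 / 2 * (x + y - 2 * (a * b))" by blast
  moreover have "u \<le> 7 / 12 * (x + y) + 3 / 2 * (l + y - x)"
    if "2 * x - 2 * r \<le> l" "u \<le> m" "m \<le> 7 / 12 * (x + y) + 3 / 2 * (x + y - 2 * r)" for u m r l :: real
    using that by (simp add: field_simps)
  ultimately show ?thesis using 1 2 by blast
qed

locale close_pair =
  fixes M K :: "real measure" and I :: "real set" and \<kappa> :: real
  assumes M: "dist01 M" and K: "dist01 K"
    and outside: "\<And>p. p \<notin> I \<Longrightarrow> sale M p = sale K p"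
    and inside: "\<And>p. p \<in> I \<Longrightarrow> 0 < sale M p \<and> sale M p < 1 \<and> 0 < sale K p \<and> sale K p < 1"
    and kl: "\<And>p. p \<in> I \<Longrightarrow> binary_kl (sale M p) (sale K p) \<le> \<kappa>"
begin

lemma sale_zero_iff: "sale M p = 0 \<longleftrightarrow> sale K p = 0" "sale M p = 1 \<longleftrightarrow> sale K p = 1"
  using outside[of p] inside[of p] by (cases "p \<in> I"; force)+

lemma hist_prob_zero_iff: "hist_prob M P h = 0 \<longleftrightarrow> hist_prob K P h = 0"
proof (induction h rule: rev_induct)
  case (snoc b h)
  then show ?case
    using sale_zero_iff[of "P h"] by (auto simp: hist_prob_snoc[OF M] hist_prob_snoc[OF K])
qed (simp add: hist_prob_Nil)

text \<open>Chain rule: one more query adds the binary divergence at the price asked, which is 0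
  outside \<open>I\<close> and at most \<kappa> inside.\<close>

lemma path_kl_le: "path_kl M K P n \<le> \<kappa> * expected_visits M P n I"
proof (induction n)
  case 0
  show ?case by (simp add: path_kl_def expected_visits_def hist_prob_Nil)
next
  case (Suc n)
  have split: "z * c * ln (z * c / (w * d)) = c * (z * ln (z / w)) + z * (c * ln (c / d))"
    if "0 < z" "0 < w" "0 \<le> c" "0 \<le> d" "c = 0 \<longleftrightarrow> d = 0" for z w c d :: real
  proof (cases "c = 0")
    case False
    then have "ln (z * c / (w * d)) = ln (z / w) + ln (c / d)"
      using that by (simp add: ln_div ln_mult)
    then show ?thesis by (simp add: algebra_simps)
  qed simp
  have step: "hist_prob M P (h @ [True]) * ln (hist_prob M P (h @ [True]) / hist_prob K P (h @ [True]))
      + hist_prob M P (h @ [False]) * ln (hist_prob M P (h @ [False]) / hist_prob K P (h @ [False]))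
      \<le> hist_prob M P h * ln (hist_prob M P h / hist_prob K P h) + \<kappa> * (hist_prob M P h * of_bool (P h \<in> I))" for h
  proof (cases "hist_prob M P h = 0")
    case True
    then show ?thesis by (simp add: hist_prob_snoc[OF M])
  next
    case False
    let ?x = "hist_prob M P h" and ?y = "hist_prob K P h" and ?a = "sale M (P h)" and ?b = "sale K (P h)"
    have xy: "0 < ?x" "0 < ?y"
      using False hist_prob_zero_iff[of P h] hist_prob_nonneg[OF M, of P h] hist_prob_nonneg[OF K, of P h] by auto
    have bd: "0 \<le> ?a" "?a \<le> 1" "0 \<le> ?b" "?b \<le> 1" using sale_bounds[OF M] sale_bounds[OF K] by auto
    have "?x * ?a * ln (?x * ?a / (?y * ?b)) + ?x * (1 - ?a) * ln (?x * (1 - ?a) / (?y * (1 - ?b)))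
      = ?x * ln (?x / ?y) + ?x * binary_kl ?a ?b"
      using split[OF xy, of ?a ?b] split[OF xy, of "1 - ?a" "1 - ?b"] bd sale_zero_iff[of "P h"]
      by (simp add: binary_kl_def algebra_simps)
    moreover have "?x * binary_kl ?a ?b \<le> \<kappa> * (?x * of_bool (P h \<in> I))"
    proof (cases "P h \<in> I")
      case True
      then show ?thesis using mult_left_mono[OF kl[OF True], of ?x] xy by (simp add: mult.commute)
    next
      case False
      then show ?thesis using outside[OF False] by (simp add: binary_kl_def)
    qed
    ultimately show ?thesis by (simp add: hist_prob_snoc[OF M] hist_prob_snoc[OF K])
  qed
  have "path_kl M K P (Suc n) \<le> path_kl M K P n + \<kappa> * (\<Sum>h | length h = n. hist_prob M P h * of_bool (P h \<in> I))"
    unfolding path_kl_def sum_lists_Suc sum_distrib_left sum.distrib[symmetric] by (intro sum_mono step)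
  with Suc show ?case by (simp add: expected_visits_def distrib_left)
qed

text \<open>By \<open>sep\<close> no output succeeds for both distributions, so
  \<open>disjoint_events_le\<close> applies history by history; its terms \<open>y - x\<close>
  cancel because both laws have total mass 1.\<close>

lemma det_success_add_le:
  assumes sep: "\<And>G. \<not> (levy (cdf M) G \<le> ereal e \<and> levy (cdf K) G \<le> ereal e)"
  shows "det_success M A n e + det_success K A n e \<le> 7 / 6 + 3 / 2 * (\<kappa> * expected_visits M (fst A) n I)"
proof -
  let ?P = "fst A"
  let ?x = "hist_prob M ?P" and ?y = "hist_prob K ?P"
  let ?c = "\<lambda>h. if levy (cdf M) (snd A h) \<le> ereal e then 1 else 0 :: real"
  let ?d = "\<lambda>h. if levy (cdf K) (snd A h) \<le> ereal e then 1 else 0 :: real"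
  have "det_success M A n e + det_success K A n e = (\<Sum>h | length h = n. ?x h * ?c h + ?y h * ?d h)"
    by (simp add: det_success_def sum.distrib)
  also have "\<dots> \<le> (\<Sum>h | length h = n. 7 / 12 * (?x h + ?y h) + 3 / 2 * (?x h * ln (?x h / ?y h) + ?y h - ?x h))"
  proof (rule sum_mono)
    fix h
    show "?x h * ?c h + ?y h * ?d h \<le> 7 / 12 * (?x h + ?y h) + 3 / 2 * (?x h * ln (?x h / ?y h) + ?y h - ?x h)"
    proof (cases "?x h = 0")
      case True
      then show ?thesis using hist_prob_zero_iff[of ?P h] by simp
    next
      case False
      then have "0 < ?x h" "0 < ?y h"
        using hist_prob_zero_iff[of ?P h] hist_prob_nonneg[OF M, of ?P h] hist_prob_nonneg[OF K, of ?P h] by auto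
      then show ?thesis by (rule disjoint_events_le) (use sep[of "snd A h"] in auto)
    qed
  qed
  also have "\<dots> = 7 / 6 + 3 / 2 * path_kl M K ?P n"
    using sum_hist_prob[OF M, of ?P n] sum_hist_prob[OF K, of ?P n]
    by (simp add: path_kl_def sum.distrib sum_subtractf flip: sum_distrib_left sum_divide_distrib)
  also have "\<dots> \<le> 7 / 6 + 3 / 2 * (\<kappa> * expected_visits M ?P n I)" using path_kl_le by simp
  finally show ?thesis .
qed

end

text \<open>Each query falls into at most one of the disjoint sets, so the sets have to share the
  \<open>n\<close> queries.\<close>

lemma sum_expected_visits_le:
  assumes M: "dist01 M" and J: "finite J" and disj: "disjoint_family_on I J"
  shows "(\<Sum>i\<in>J. expected_visits M P n (I i)) \<le> real n"
proof -
  have "(\<Sum>i\<in>J. expected_visits M P n (I i))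
      = (\<Sum>t<n. \<Sum>h | length h = t. hist_prob M P h * (\<Sum>i\<in>J. of_bool (P h \<in> I i)))"
    unfolding expected_visits_def sum_distrib_left
    by (subst sum.swap, intro sum.cong refl, subst sum.swap, rule refl)
  also have "\<dots> \<le> (\<Sum>t<n. \<Sum>h | length h = t. hist_prob M P h * 1)"
  proof (intro sum_mono mult_left_mono hist_prob_nonneg[OF M])
    fix h
    have "(\<Sum>i\<in>J. of_bool (P h \<in> I i)) = real (card {i\<in>J. P h \<in> I i})"
      using J by (simp add: of_bool_def sum.If_cases Int_def)
    also have "card {i\<in>J. P h \<in> I i} \<le> Suc 0"
      unfolding card_le_Suc0_iff_eq[OF finite_subset[OF _ J, of "{i\<in>J. P h \<in> I i}"], simplified]
      using disj by (auto simp: disjoint_family_on_def)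
    finally show "(\<Sum>i\<in>J. of_bool (P h \<in> I i)) \<le> (1::real)" by simp
  qed
  finally show ?thesis using sum_hist_prob[OF M] by simp
qed

text \<open>No measurability is assumed, so the integrals below are lower integrals.\<close>
lemma nn_integral_superadd:
  "(\<integral>\<^sup>+ x. f x \<partial>M) + (\<integral>\<^sup>+ x. g x \<partial>M) \<le> (\<integral>\<^sup>+ x. f x + g x \<partial>M)"
proof -
  let ?S = "\<lambda>f. {u. simple_function M u \<and> u \<le> f}"
  have ne: "?S f \<noteq> {}" for f :: "'a \<Rightarrow> ennreal" by (auto intro!: exI[of _ "\<lambda>_. 0"] simp: le_fun_def)
  have "integral\<^sup>S M u + integral\<^sup>S M v \<le> (\<integral>\<^sup>+ x. f x + g x \<partial>M)" if "u \<in> ?S f" "v \<in> ?S g" for u v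
  proof -
    have "integral\<^sup>S M u + integral\<^sup>S M v = integral\<^sup>S M (\<lambda>x. u x + v x)"
      using that by (subst simple_integral_add) auto
    also have "\<dots> \<le> (\<integral>\<^sup>+ x. f x + g x \<partial>M)"
      unfolding nn_integral_def using that by (intro SUP_upper) (auto simp: le_fun_def intro!: add_mono)
    finally show ?thesis .
  qed
  then show ?thesis
    unfolding nn_integral_def[of M f] nn_integral_def[of M g]
    by (subst ennreal_SUP_add_left[OF ne, symmetric], intro SUP_least,
        subst ennreal_SUP_add_right[OF ne], intro SUP_least) blast
qed

lemma nn_integral_sum_superadd:
  "finite J \<Longrightarrow> (\<Sum>i\<in>J. \<integral>\<^sup>+ x. f i x \<partial>M) \<le> (\<integral>\<^sup>+ x. (\<Sum>i\<in>J. f i x) \<partial>M)"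
proof (induction J rule: finite_induct)
  case (insert i J)
  show ?case
    unfolding sum.insert[OF insert.hyps]
    by (rule order_trans[OF add_left_mono[OF insert.IH] nn_integral_superadd])
qed simp

section \<open>The family of bumps\<close>

lemma convex_on_max_real:
  fixes f g :: "real \<Rightarrow> real"
  assumes f: "convex_on S f" and g: "convex_on S g" shows "convex_on S (\<lambda>x. max (f x) (g x))"
proof (rule convex_onI)
  fix t x y assume t: "0 < t" "t < (1::real)" and xy: "x \<in> S" "y \<in> S"
  have "(1 - t) * f x + t * f y \<le> (1 - t) * max (f x) (g x) + t * max (f y) (g y)"
    "(1 - t) * g x + t * g y \<le> (1 - t) * max (f x) (g x) + t * max (f y) (g y)"
    using t by (intro add_mono mult_left_mono; simp)+
  then show "max (f ((1 - t) *\<^sub>R x + t *\<^sub>R y)) (g ((1 - t) *\<^sub>R x + t *\<^sub>R y))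
      \<le> (1 - t) * max (f x) (g x) + t * max (f y) (g y)"
    using convex_onD[OF f, of t x y] convex_onD[OF g, of t x y] t xy by auto
qed (use f in \<open>simp add: convex_on_def\<close>)

text \<open>Constant curvature makes secants over intervals of equal width rise equally high above
  the graph.\<close>

definition base_h :: "real \<Rightarrow> real" where
  "base_h v = 1 + v\<^sup>2"

text \<open>The secant of \<open>base_h\<close> lies above it exactly on \<open>{a..b}\<close>, so the maximum changes nothing else.\<close>
definition bump_h :: "real \<Rightarrow> real \<Rightarrow> real \<Rightarrow> real" where
  "bump_h a b v = max (base_h v) (1 + (a + b) * v - a * b)"

lemma secant_diff: "(1 + (a + b) * v - a * b) - base_h v = (v - a) * (b - v)"
  by (simp add: base_h_def power2_eq_square algebra_simps)

text \<open>This gives \<open>1 / base_h\<close> Lipschitz constant 1 on nonnegative prices: the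
  difference quotient is \<open>(x + y) / (base_h x * base_h y)\<close> up to sign.\<close>

lemma add_le_base_h_mult: "x + y \<le> base_h x * base_h y"
proof -
  have "base_h x * base_h y = 1 + x\<^sup>2 + y\<^sup>2 + (x * y)\<^sup>2"
    by (simp add: base_h_def power_mult_distrib algebra_simps)
  moreover have "2 * x \<le> x\<^sup>2 + 1" "2 * y \<le> y\<^sup>2 + 1"
    using sum_squares_bound[of x 1] sum_squares_bound[of y 1] by simp_all
  moreover have "0 \<le> x\<^sup>2" "0 \<le> y\<^sup>2" "0 \<le> (x * y)\<^sup>2" by auto
  ultimately show ?thesis by linarith
qed

lemma convex_base_h: "convex_on {0..1} base_h"
proof (rule convex_onI)
  fix t x y :: real assume t: "0 < t" "t < 1"
  have "(1 - t) * base_h x + t * base_h y - base_h ((1 - t) *\<^sub>R x + t *\<^sub>R y) = t * (1 - t) * (x - y)\<^sup>2"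
    by (simp add: base_h_def power2_eq_square algebra_simps)
  moreover have "0 \<le> t * (1 - t) * (x - y)\<^sup>2" using t by simp
  ultimately show "base_h ((1 - t) *\<^sub>R x + t *\<^sub>R y) \<le> (1 - t) * base_h x + t * base_h y" by linarith
qed simp

lemma base_h_strict: "0 \<le> x \<Longrightarrow> x < y \<Longrightarrow> base_h x < base_h y"
  by (simp add: base_h_def power_strict_mono)

interpretation base: reciprocal_sale base_h
proof
  show "isCont base_h v" for v unfolding base_h_def by (intro continuous_intros)
qed (use base_h_strict in \<open>auto simp: convex_base_h base_h_def\<close>)

lemma reciprocal_sale_bump:
  assumes "0 \<le> a" "0 < b" shows "reciprocal_sale (bump_h a b)"
proof
  show "isCont (bump_h a b) v" for v unfolding bump_h_def base_h_def by (intro continuous_intros)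
  have "convex_on {0..1} (\<lambda>v. 1 + (a + b) * v - a * b)"
    by (rule convex_onI) (auto simp: algebra_simps)
  then show "convex_on {0..1} (bump_h a b)"
    unfolding bump_h_def by (rule convex_on_max_real[OF convex_base_h])
  show "bump_h a b x < bump_h a b y" if "0 \<le> x" "x < y" for x y
  proof -
    have "(a + b) * x < (a + b) * y" using that assms by (intro mult_strict_left_mono) auto
    with base_h_strict[OF that] show ?thesis by (auto simp: bump_h_def)
  qed
  show "bump_h a b 0 = 1" using assms by (simp add: bump_h_def base_h_def)
qed

definition bump :: "real \<Rightarrow> real \<Rightarrow> real measure" where
  "bump a b = reciprocal_sale.market (bump_h a b)"

lemma bump_h_outside: "p \<notin> {a<..<b} \<Longrightarrow> a \<le> b \<Longrightarrow> bump_h a b p = base_h p"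
proof -
  assume "p \<notin> {a<..<b}" "a \<le> b"
  then have "(p - a) * (b - p) \<le> 0" by (auto simp: mult_le_0_iff)
  then show ?thesis using secant_diff[of a b p] by (simp add: bump_h_def)
qed

lemma bump_h_inside: "p \<in> {a<..<b} \<Longrightarrow> bump_h a b p = base_h p + (p - a) * (b - p)"
proof -
  assume "p \<in> {a<..<b}"
  then have "0 \<le> (p - a) * (b - p)" by auto
  then show ?thesis using secant_diff[of a b p] by (simp add: bump_h_def)
qed

section \<open>A single bump against the base distribution\<close>

context
  fixes e a b :: real
  assumes e: "0 < e" "e < 1" and ab: "1 / 2 \<le> a" "b = a + 12 * sqrt e" "b \<le> 1"
begin

lemma lt_ab: "a < b" using e ab by simp

interpretation bm: reciprocal_sale "bump_h a b"
proof (rule reciprocal_sale_bump)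
  show "0 \<le> a" "0 < b" using ab(1) lt_ab by linarith+
qed

text \<open>Prices beyond \<open>1 / 2\<close> keep the sale probabilities between
  \<open>1 / 2\<close> and \<open>4 / 5\<close>, away from 0 and 1, where the divergence bound
  degenerates.\<close>

lemma bump_le_2: "p \<in> {a<..<b} \<Longrightarrow> 5 / 4 \<le> base_h p \<and> base_h p \<le> bump_h a b p \<and> bump_h a b p \<le> 2"
proof -
  assume p: "p \<in> {a<..<b}"
  have "(1 / 2)\<^sup>2 \<le> p\<^sup>2" using p ab by (intro power_mono) auto
  then have "5 / 4 \<le> base_h p" by (simp add: base_h_def power2_eq_square)
  moreover have "base_h p \<le> bump_h a b p" by (simp add: bump_h_def)
  moreover have "bump_h a b p \<le> bump_h a b 1" using p ab by (intro bm.mono_h) auto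
  moreover have "bump_h a b 1 = 2" using bump_h_outside[of 1 a b] ab lt_ab by (simp add: base_h_def)
  ultimately show ?thesis by simp
qed

lemma bump_gap: "p \<in> {a<..<b} \<Longrightarrow> (p - a) * (b - p) \<le> 36 * e"
proof -
  have "(p - a) * (b - p) = (b - a)\<^sup>2 / 4 - (p - (a + b) / 2)\<^sup>2"
    by (simp add: power2_eq_square field_simps)
  also have "\<dots> \<le> (b - a)\<^sup>2 / 4" by simp
  also have "\<dots> = 36 * e" using ab e by (simp add: power_mult_distrib)
  finally show ?thesis .
qed

text \<open>The constant is \<open>36^2 / (4 / 25)\<close>: the sale probabilities differ by at most
  \<open>36 * e\<close>, and \<open>4 / 25\<close> is the least Bernoulli variance on
  \<open>[1 / 2, 4 / 5]\<close>.\<close>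

lemma close_pair_bump: "close_pair base.market (bump a b) {a<..<b} (8100 * e\<^sup>2)"
  unfolding bump_def
proof
  show "dist01 base.market" "dist01 bm.market" by (rule base.dist01_market bm.dist01_market)+
  show "sale base.market p = sale bm.market p" if "p \<notin> {a<..<b}" for p
  proof -
    consider "p < 0" | "1 < p" | "0 \<le> p" "p \<le> 1" by linarith
    then show ?thesis
    proof cases
      case 3
      then show ?thesis
        using base.sale_market bm.sale_market bump_h_outside[OF that] lt_ab by simp
    qed (simp_all add: sale_nonpos sale_gt_1 base.dist01_market bm.dist01_market)
  qed
  fix p assume p: "p \<in> {a<..<b}"
  then have p01: "0 \<le> p" "p \<le> 1" using ab by auto
  let ?f = "base_h p" and ?g = "bump_h a b p"
  note bd = bump_le_2[OF p]
  have S: "sale base.market p = 1 / ?f" "sale bm.market p = 1 / ?g"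
    using base.sale_market[OF p01] bm.sale_market[OF p01] by auto
  show A: "0 < sale base.market p \<and> sale base.market p < 1 \<and> 0 < sale bm.market p \<and> sale bm.market p < 1"
    unfolding S using bd by auto
  have "\<bar>1 / ?f - 1 / ?g\<bar> \<le> 36 * e"
  proof -
    have "1 / ?f - 1 / ?g = ((p - a) * (b - p)) / (?f * ?g)"
      using bump_h_inside[OF p] bd by (simp add: field_simps)
    also have "\<dots> \<le> ((p - a) * (b - p)) / (1 * 1)"
      using bd p by (intro divide_left_mono mult_mono) auto
    also have "\<dots> \<le> 36 * e" using bump_gap[OF p] by simp
    finally have "1 / ?f - 1 / ?g \<le> 36 * e" .
    moreover have "0 \<le> 1 / ?f - 1 / ?g" using bd by (simp add: frac_le)
    ultimately show ?thesis by simp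
  qed
  then have sq: "(1 / ?f - 1 / ?g)\<^sup>2 \<le> (36 * e)\<^sup>2" by (rule power2_le_iff_abs_le[THEN iffD2, rotated]) (use e in simp)
  have "0 < ?g" "5 / 4 \<le> ?g" using bd by linarith+
  then have "1 / 2 \<le> 1 / ?g" "1 / ?g \<le> 4 / 5" using bd by (simp_all add: pos_divide_le_eq pos_le_divide_eq)
  then have "4 / 25 \<le> 1 / ?g * (1 - 1 / ?g)"
  proof -
    assume s: "1 / 2 \<le> 1 / ?g" "1 / ?g \<le> 4 / 5"
    define s where "s = 1 / ?g"
    have "0 \<le> (s - 1 / 2) * (4 / 5 - s)" using s by (simp add: s_def)
    also have "(s - 1 / 2) * (4 / 5 - s) = s * (1 - s) + 3 / 10 * s - 2 / 5" by (simp add: field_simps)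
    finally have "4 / 25 \<le> s * (1 - s)" using s(2) unfolding s_def[symmetric] by simp
    then show ?thesis by (simp add: s_def)
  qed
  then have "binary_kl (1 / ?f) (1 / ?g) \<le> (36 * e)\<^sup>2 / (4 / 25)"
    using A[unfolded S] sq by (intro order_trans[OF binary_kl_le] frac_le) auto
  then show "binary_kl (sale base.market p) (sale bm.market p) \<le> 8100 * e\<^sup>2"
    unfolding S by (simp add: power2_eq_square)
qed

text \<open>Comparing through \<open>G\<close> at \<open>m + 2 * e\<close> allows a vertical error
  \<open>4 * e\<close>, and the horizontal shift \<open>4 * e\<close> costs at most
  \<open>4 * e\<close> more. The sale probabilities at the midpoint differ by at least
  \<open>9 * e\<close>.\<close>

lemma levy_bump:
  "\<not> (levy (cdf base.market) G \<le> ereal e \<and> levy (cdf (bump a b)) G \<le> ereal e)"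
proof
  assume L: "levy (cdf base.market) G \<le> ereal e \<and> levy (cdf (bump a b)) G \<le> ereal e"
  define m where "m = (a + b) / 2"
  have m: "m \<in> {a<..<b}" using lt_ab by (simp add: m_def)
  have "sqrt e * sqrt e < 1 * sqrt e" using e by (intro mult_strict_right_mono) (auto simp: real_sqrt_lt_1_iff)
  then have es: "e < sqrt e" using e by simp
  have "m = b - 6 * sqrt e" using ab by (simp add: m_def field_simps)
  then have me: "0 \<le> m" "m + 4 * e < 1" using m ab(1,3) es e by auto
  have "1 - 1 / bump_h a b m = cdf (bump a b) m"
    using me e by (simp add: bump_def bm.cdf_market truncated_cdf_def)
  also have "\<dots> \<le> G (m + 2 * e) + 2 * e"
    using levy_leD(1)[of "cdf (bump a b)" G e "2 * e" "m + 2 * e"] L e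
    by (simp add: bump_def bm.cdf_market bm.truncated_cdf_mono mono_def)
  also have "G (m + 2 * e) \<le> cdf base.market (m + 4 * e) + 2 * e"
    using levy_leD(2)[of "cdf base.market" G e "2 * e" "m + 2 * e"] L e
    by (simp add: base.cdf_market base.truncated_cdf_mono mono_def add.assoc)
  also have "cdf base.market (m + 4 * e) = 1 - 1 / base_h (m + 4 * e)"
    using me e by (simp add: base.cdf_market truncated_cdf_def)
  finally have 1: "1 / base_h (m + 4 * e) \<le> 1 / bump_h a b m + 4 * e" by simp
  have 2: "1 / base_h m - 4 * e \<le> 1 / base_h (m + 4 * e)"
  proof -
    let ?u = "m + 4 * e"
    have pos: "0 < base_h m" "0 < base_h ?u" by (auto simp: base_h_def add_pos_nonneg)
    have "1 / base_h m - 1 / base_h ?u = 4 * e * ((m + ?u) / (base_h m * base_h ?u))"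
      using pos by (simp add: field_simps) (simp add: base_h_def power2_eq_square algebra_simps)
    also have "\<dots> \<le> 4 * e * 1"
    proof (intro mult_left_mono)
      have "m + ?u \<le> base_h m * base_h ?u" by (rule add_le_base_h_mult)
      then show "(m + ?u) / (base_h m * base_h ?u) \<le> 1" using pos by simp
    qed (use e in simp)
    finally show ?thesis by simp
  qed
  have 3: "9 * e \<le> 1 / base_h m - 1 / bump_h a b m"
  proof -
    note bd = bump_le_2[OF m]
    have "m - a = 6 * sqrt e" "b - m = 6 * sqrt e" using ab by (simp_all add: m_def field_simps)
    then have "(m - a) * (b - m) = 36 * e" using e by simp
    then have "1 / base_h m - 1 / bump_h a b m = 36 * e / (base_h m * bump_h a b m)"
      using bump_h_inside[OF m] bd by (simp add: field_simps)
    moreover have "36 * e / (2 * 2) \<le> 36 * e / (base_h m * bump_h a b m)"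
      using bd e by (intro divide_left_mono mult_mono mult_pos_pos) auto
    ultimately show ?thesis by simp
  qed
  from 1 2 3 e show False by simp
qed

lemma regular01_bump: "regular01 (bump a b)"
  unfolding bump_def by (rule bm.regular01_market)

end

section \<open>Averaging over all bumps\<close>

lemma det_success_nonneg: "dist01 M \<Longrightarrow> 0 \<le> det_success M A n e"
  unfolding det_success_def by (intro sum_nonneg mult_nonneg_nonneg hist_prob_nonneg) auto

text \<open>Two success probabilities of \<open>2 / 3\<close> exceed \<open>7 / 6\<close> by
  \<open>1 / 6\<close>, and each bump has to pay this excess with queries in its own interval. The
  inequality summed over all bumps holds for every deterministic algorithm and is then integrated
  over \<open>Q\<close>.\<close>

lemma pricing_lower_bound:
  "\<exists>c>0. \<exists>\<epsilon>0>0. \<forall>\<epsilon>\<in>{0<..<\<epsilon>0}. \<forall>(n::nat) (Q::pricing_alg measure).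
            prob_space Q \<and> (\<forall>M. regular01 M \<longrightarrow> rand_success Q M n \<epsilon> \<ge> ennreal (2/3))
            \<longrightarrow> real n \<ge> c * \<epsilon> powr (-5/2)"
proof (intro exI conjI ballI allI impI)
  \<comment> \<open>\<open>48 = 4 * 12\<close> comes from \<open>K >= 1 / (4 * w)\<close> and
    \<open>72900 = 6 * (3 / 2) * 8100\<close> from the excess \<open>1 / 6\<close>. Below
    \<open>1 / 576\<close> the width is at most \<open>1 / 2\<close>, so at least one bump fits into
    \<open>[1 / 2, 1]\<close>.\<close>
  show "0 < (1 / (48 * 72900) :: real)" "0 < (1 / 576 :: real)" by auto
  fix e :: real and n :: nat and Q :: "pricing_alg measure"
  assume "e \<in> {0<..<1/576}"
    and Q: "prob_space Q \<and> (\<forall>M. regular01 M \<longrightarrow> ennreal (2/3) \<le> rand_success Q M n e)"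
  then have e: "0 < e" "e < 1" and e': "e < 1 / 576" by auto
  interpret Q: prob_space Q using Q by simp
  define w where "w = 12 * sqrt e"
  have s24: "sqrt e \<le> 1 / 24"
    using e e' by (intro real_le_lsqrt) (auto simp: power2_eq_square)
  have w: "0 < w" "w \<le> 1 / 2" using e s24 by (auto simp: w_def)
  define K where "K = nat \<lfloor>1 / (2 * w)\<rfloor>"
  have Kle: "real K \<le> 1 / (2 * w)" and Kge: "1 / (4 * w) \<le> real K"
  proof -
    have "1 \<le> 1 / (2 * w)" using w by simp
    moreover have "1 \<le> real (nat \<lfloor>r\<rfloor>)" "real (nat \<lfloor>r\<rfloor>) \<le> r" "r < real (nat \<lfloor>r\<rfloor>) + 1"
      if "1 \<le> r" for r :: real
    proof -
      have "1 \<le> \<lfloor>r\<rfloor>" using that by simp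
      then show "1 \<le> real (nat \<lfloor>r\<rfloor>)" "real (nat \<lfloor>r\<rfloor>) \<le> r" "r < real (nat \<lfloor>r\<rfloor>) + 1"
        by linarith+
    qed
    ultimately have "1 \<le> real K" "real K \<le> 1 / (2 * w)" "1 / (2 * w) < real K + 1" unfolding K_def by blast+
    moreover have "1 / (4 * w) = 1 / (2 * w) / 2" by simp
    ultimately show "real K \<le> 1 / (2 * w)" "1 / (4 * w) \<le> real K" by linarith+
  qed
  define a where "a i = 1 / 2 + real i * w" for i
  define b where "b i = a i + 12 * sqrt e" for i
  have b_eq: "b i = 1 / 2 + (real i + 1) * w" for i
    by (simp add: a_def b_def w_def algebra_simps)
  have ab: "1 / 2 \<le> a i" "b i \<le> 1" if "i < K" for i
  proof -
    show "1 / 2 \<le> a i" using w by (simp add: a_def)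
    have "(real i + 1) * w \<le> real K * w" using that w by (intro mult_right_mono) auto
    also have "\<dots> \<le> 1 / (2 * w) * w" using Kle w by (intro mult_right_mono) auto
    finally show "b i \<le> 1" using w unfolding b_eq by simp
  qed
  define I where "I i = {a i<..<b i}" for i
  have disj: "disjoint_family_on I {..<K}"
    unfolding disjoint_family_on_def
  proof (intro ballI impI)
    have *: "I i \<inter> I j = {}" if "i < j" for i j
    proof -
      have "(real i + 1) * w \<le> real j * w" using that w by (intro mult_right_mono) auto
      then have "b i \<le> a j" unfolding b_eq a_def by simp
      then show ?thesis by (auto simp: I_def)
    qed
    fix i j :: nat assume "i \<noteq> j"
    then show "I i \<inter> I j = {}" using *[of i j] *[of j i] by (cases "i < j") auto
  qed
  let ?\<kappa> = "8100 * e\<^sup>2"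
  let ?M = "base.market" and ?K = "\<lambda>i. bump (a i) (b i)"
  note M = base.dist01_market
  have reg: "regular01 (?K i)" if "i < K" for i
    by (rule regular01_bump[OF e ab(1)[OF that] b_def ab(2)[OF that]])
  have det: "(\<Sum>i<K. det_success ?M A n e + det_success (?K i) A n e) \<le> 7 / 6 * real K + 3 / 2 * ?\<kappa> * real n" for A
  proof -
    have "(\<Sum>i<K. det_success ?M A n e + det_success (?K i) A n e)
        \<le> (\<Sum>i<K. 7 / 6 + 3 / 2 * (?\<kappa> * expected_visits ?M (fst A) n (I i)))"
    proof (rule sum_mono)
      fix i assume "i \<in> {..<K}"
      then have i: "i < K" by simp
      note h = e ab(1)[OF i] b_def[of i] ab(2)[OF i]
      interpret close_pair ?M "?K i" "I i" ?\<kappa> unfolding I_def by (rule close_pair_bump[OF h])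
      show "det_success ?M A n e + det_success (?K i) A n e
          \<le> 7 / 6 + 3 / 2 * (?\<kappa> * expected_visits ?M (fst A) n (I i))"
        by (rule det_success_add_le[OF levy_bump[OF h]])
    qed
    also have "\<dots> = 7 / 6 * real K + 3 / 2 * ?\<kappa> * (\<Sum>i<K. expected_visits ?M (fst A) n (I i))"
      by (simp add: sum.distrib sum_distrib_left mult.assoc)
    also have "\<dots> \<le> 7 / 6 * real K + 3 / 2 * ?\<kappa> * real n"
      using sum_expected_visits_le[OF M _ disj] by (intro add_left_mono mult_left_mono) auto
    finally show ?thesis .
  qed
  have "ennreal (4 / 3 * real K) = ennreal (\<Sum>i<K. 2 / 3 + 2 / 3)" by (simp add: mult.commute)
  also have "\<dots> = (\<Sum>i<K. ennreal (2 / 3) + ennreal (2 / 3))"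
    unfolding ennreal_plus[of "2 / 3" "2 / 3", simplified, symmetric] by (subst sum_ennreal) auto
  also have "\<dots> \<le> (\<Sum>i<K. rand_success Q ?M n e + rand_success Q (?K i) n e)"
    using Q base.regular01_market reg by (intro sum_mono add_mono) auto
  also have "\<dots> \<le> (\<Sum>i<K. \<integral>\<^sup>+ A. ennreal (det_success ?M A n e) + ennreal (det_success (?K i) A n e) \<partial>Q)"
    unfolding rand_success_def by (intro sum_mono nn_integral_superadd)
  also have "\<dots> \<le> (\<integral>\<^sup>+ A. (\<Sum>i<K. ennreal (det_success ?M A n e) + ennreal (det_success (?K i) A n e)) \<partial>Q)"
    by (intro nn_integral_sum_superadd) simp
  also have "\<dots> \<le> (\<integral>\<^sup>+ A. ennreal (7 / 6 * real K + 3 / 2 * ?\<kappa> * real n) \<partial>Q)"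
  proof (rule nn_integral_mono)
    fix A
    have nn: "0 \<le> det_success ?M A n e" "\<And>i. i < K \<Longrightarrow> 0 \<le> det_success (?K i) A n e"
      using det_success_nonneg M reg by (auto simp: regular01_def)
    have "(\<Sum>i<K. ennreal (det_success ?M A n e) + ennreal (det_success (?K i) A n e))
        = (\<Sum>i<K. ennreal (det_success ?M A n e + det_success (?K i) A n e))"
      using nn by (intro sum.cong) auto
    also have "\<dots> = ennreal (\<Sum>i<K. det_success ?M A n e + det_success (?K i) A n e)"
      using nn by (intro sum_ennreal) auto
    also have "\<dots> \<le> ennreal (7 / 6 * real K + 3 / 2 * ?\<kappa> * real n)" by (intro ennreal_leI det)
    finally show "(\<Sum>i<K. ennreal (det_success ?M A n e) + ennreal (det_success (?K i) A n e))
        \<le> ennreal (7 / 6 * real K + 3 / 2 * ?\<kappa> * real n)" .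
  qed
  also have "\<dots> = ennreal (7 / 6 * real K + 3 / 2 * ?\<kappa> * real n)"
    by (simp add: Q.emeasure_space_1)
  finally have "4 / 3 * real K \<le> 7 / 6 * real K + 3 / 2 * ?\<kappa> * real n"
    by (subst (asm) ennreal_le_iff) auto
  then have "1 / (4 * w) \<le> 72900 * e\<^sup>2 * real n" using Kge by simp
  then have "1 / (48 * 72900) * (1 / sqrt e * (1 / e\<^sup>2)) \<le> real n"
    using e by (simp add: w_def field_simps)
  moreover have "e powr (-5/2) = 1 / sqrt e * (1 / e\<^sup>2)"
  proof -
    have "e powr (-5/2) = e powr (-1/2) * e powr (-2)" using powr_add[of e "-1/2" "-2"] by simp
    also have "e powr (-1/2) = 1 / sqrt e" using powr_minus_divide[of e "1/2"] powr_half_sqrt[of e] e by simp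
    also have "e powr (-2) = 1 / e\<^sup>2" using powr_minus_divide[of e 2] e by simp
    finally show ?thesis .
  qed
  ultimately show "1 / (48 * 72900) * e powr (-5/2) \<le> real n" by simp
qed

theorem theorem3:
  shows "(\<exists>C>0. \<exists>k::nat. \<forall>\<epsilon>\<in>{0<..1/2}. \<exists>(n::nat) (Q::pricing_alg measure).
            prob_space Q \<and>
            real n \<le> C * \<epsilon> powr (-5/2) * (ln (1/\<epsilon>)) ^ k \<and>
            (\<forall>M. regular01 M \<longrightarrow> rand_success Q M n \<epsilon> \<ge> ennreal (1 - \<epsilon>)))
       \<and> (\<exists>c>0. \<exists>\<epsilon>0>0. \<forall>\<epsilon>\<in>{0<..<\<epsilon>0}. \<forall>(n::nat) (Q::pricing_alg measure).
            prob_space Q \<and> (\<forall>M. regular01 M \<longrightarrow> rand_success Q M n \<epsilon> \<ge> ennreal (2/3))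
            \<longrightarrow> real n \<ge> c * \<epsilon> powr (-5/2))"
  using pricing_upper_bound pricing_lower_bound by (rule conjI)

end
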